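(* Let $\mathscr{D}$ be a generalized dyadic grid in $\mathbb{R}^n$, let $\mathcal{S}$ be a generalized Haar shift operator of complexity $\kappa$ with respect to $\mathscr{D}$, let $\mathcal{S}_\star$ be the associated truncated Haar shift operator, and let $M_{\mathscr{D}}$ be the dyadic maximal operator associated with $\mathscr{D}$. Let $1<p<q<\infty$ and let $(u,v)$ be a pair of weights. (i) If $M_{\mathscr{D}}$ satisfies both $$M_{\mathscr{D}}: L^p(v)\to L^q(u)\quad\text{and}\quad M_{\mathscr{D}}: L^{q'}(u^{1-q'})\to L^{p'}(v^{1-p'}),$$ then $$\|\mathcal{S}f\|_{L^q(u)}\le C\kappa^2\|f\|_{L^p(v)}\quad\text{and}\quad\|\mathcal{S}_\star f\|_{L^q(u)}\le C\kappa^2\|f\|_{L^p(v)}.$$ (ii) Analogously, if $M_{\mathscr{D}}$ satisfies $$M_{\mathscr{D}}: L^{q'}(u^{1-q'})\to L^{p'}(v^{1-p'}),$$ then $$\|\mathcal{S}f\|_{L^{q,\infty}(u)}\le C\kappa^2\|f\|_{L^p(v)}\quad\text{and}\quad\|\mathcal{S}_\star f\|_{L^{q,\infty}(u)}\le C\kappa^2\|f\|_{L^p(v)}.$$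
   Context: Weights are non-negative measurable functions on $\mathbb{R}^n$ (the value $\infty$ is allowed). For a pair of weights $(u,v)$ it is assumed throughout that $u>0$ on a set of positive measure and $u<\infty$ a.e., and that $v>0$ a.e. and $v<\infty$ on a set of positive measure. The convention $0\cdot\infty=0$ is used. Here $p'=p/(p-1)$ and $q'=q/(q-1)$. In the conclusions, $C$ denotes a constant that does not depend on $f$. For a weight $w$ and $1<r<\infty$, $\|f\|_{L^r(w)}=\left(\int_{\mathbb{R}^n}|f(x)|^r w(x)\,dx\right)^{1/r}$ and $\|f\|_{L^{r,\infty}(w)}=\sup_{\lambda>0}\lambda\left(\int_{\{x:|f(x)|>\lambda\}}w(x)\,dx\right)^{1/r}$. The notation $M_{\mathscr{D}}:L^r(w_1)\to L^s(w_2)$ means that $M_{\mathscr{D}}$ is bounded from $L^r(w_1)$ to $L^s(w_2)$, i.e. there is a finite constant $A$ with $\|M_{\mathscr{D}}f\|_{L^s(w_2)}\le A\|f\|_{L^r(w_1)}$ for all $f\in L^r(w_1)$. A generalized dyadic grid $\mathscr{D}$ in $\mathbb{R}^n$ is a set of cubes such that: every $Q\in\mathscr{D}$ has side length $\ell(Q)=2^k$ for some $k\in\mathbb{Z}$; if $Q,R\in\mathscr{D}$ and $Q\cap R\ne\emptyset$, then $Q\subset R$ or $R\subset Q$; and for each $k\in\mathbb{Z}$ the cubes in $\mathscr{D}$ with $\ell(Q)=2^{-k}$ form a disjoint partition of $\mathbb{R}^n$. For $Q\in\mathscr{D}$ and an integer $j\ge0$, $\mathscr{D}_j(Q)$ is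 the set of cubes $R\in\mathscr{D}$ with $R\subset Q$ and $\ell(R)=2^{-j}\ell(Q)$. The dyadic maximal operator is $$M_{\mathscr{D}}f(x)=\sup_{x\in Q\in\mathscr{D}}\frac1{|Q|}\int_Q|f(y)|\,dy.$$ A function $g_Q$ is a generalized Haar function associated with $Q\in\mathscr{D}$ if (1) $\operatorname{supp}(g_Q)\subset Q$; (2) if $Q'\in\mathscr{D}$ and $Q'\subsetneq Q$, then $g_Q$ is constant on $Q'$; (3) $\|g_Q\|_\infty\le1$. Given $\mathscr{D}$ and a pair $(m,k)$ of non-negative integers, a linear operator $\mathcal{S}$ is a generalized Haar shift operator of complexity type $(m,k)$ if it is bounded on $L^2(\mathbb{R}^n)$ and $$\mathcal{S}f(x)=\sum_{Q\in\mathscr{D}}\mathcal{S}_Qf(x)=\sum_{Q\in\mathscr{D}}\ \sum_{Q'\in\mathscr{D}_m(Q),\ Q''\in\mathscr{D}_k(Q)}\frac{\langle f,g_{Q'}^{Q''}\rangle}{|Q|}\,g_{Q''}^{Q'}(x),$$ where $g_{Q'}^{Q''}$ is a generalized Haar function associated with $Q'$, $g_{Q''}^{Q'}$ is a generalized Haar function associated with $Q''$, and $\langle\cdot,\cdot\rangle$ is the $L^2(\mathbb{R}^n)$ pairing. The complexity of $\mathcal{S}$ is $\kappa=\max(m,k)$. The truncated Haar shift operator is $$\mathcal{S}_\star f(x)=\sup_{0<\epsilon<\epsilon'<\infty}\left|\sum_{Q\in\mathscr{D},\ \epsilon\le\ell(Q)\le\epsilon'}\mathcal{S}_Qf(x)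\right|.$$
   Formalization: The factor κ² is replaced by max(1,κ)²: for κ = 0 the stated bound would force Sf = 0 where u > 0, which fails for Sf = ⟨f,1_Q⟩/|Q|·1_Q with u = 1 on one child of Q and 0 elsewhere, v = 1 on a sibling child and ∞ elsewhere; for κ ≥ 1 nothing changes. *)

theory Defs
  imports "HOL-Analysis.Analysis"
begin

section \<open>Weights and weighted norms\<close>

text \<open>Real powers of extended non-negative reals, with \<open>0 ^ a = \<infinity>\<close> and \<open>\<infinity> ^ a = 0\<close> for
  \<open>a < 0\<close>. Multiplication on \<^typ>\<open>ennreal\<close> already satisfies \<open>0 * \<infinity> = 0\<close>.\<close>

definition ennpowr :: "ennreal \<Rightarrow> real \<Rightarrow> ennreal" where
  "ennpowr x a =
    (if a = 0 then 1
     else if x = 0 then (if a < 0 then \<infinity> else 0)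
     else if x = \<infinity> then (if a < 0 then 0 else \<infinity>)
     else ennreal (enn2real x powr a))"

definition conj_exp :: "real \<Rightarrow> real" where
  "conj_exp p = p / (p - 1)"

definition weight_pair :: "((real^'n) \<Rightarrow> ennreal) \<Rightarrow> ((real^'n) \<Rightarrow> ennreal) \<Rightarrow> bool" where
  "weight_pair u v \<longleftrightarrow>
     u \<in> borel_measurable lebesgue \<and> v \<in> borel_measurable lebesgue \<and>
     emeasure lebesgue {x. u x > 0} > 0 \<and> (AE x in lebesgue. u x < \<infinity>) \<and>
     (AE x in lebesgue. v x > 0) \<and> emeasure lebesgue {x. v x < \<infinity>} > 0"

text \<open>The norms are stated for \<^typ>\<open>ennreal\<close>-valued functions, so that they apply to
  \<open>\<bar>f\<bar>\<close> as well as to maximal functions, which may take the value \<open>\<infinity>\<close>.\<close>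

definition Lnorm :: "real \<Rightarrow> ((real^'n) \<Rightarrow> ennreal) \<Rightarrow> ((real^'n) \<Rightarrow> ennreal) \<Rightarrow> ennreal" where
  "Lnorm r w F = ennpowr (\<integral>\<^sup>+x. ennpowr (F x) r * w x \<partial>lebesgue) (1 / r)"

definition weak_Lnorm :: "real \<Rightarrow> ((real^'n) \<Rightarrow> ennreal) \<Rightarrow> ((real^'n) \<Rightarrow> ennreal) \<Rightarrow> ennreal" where
  "weak_Lnorm r w F =
     (SUP t\<in>{0<..}. ennreal t * ennpowr (\<integral>\<^sup>+x\<in>{x. F x > ennreal t}. w x \<partial>lebesgue) (1 / r))"

definition absfun :: "((real^'n) \<Rightarrow> complex) \<Rightarrow> (real^'n) \<Rightarrow> ennreal" where
  "absfun f x = ennreal (norm (f x))"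

definition Lspace :: "real \<Rightarrow> ((real^'n) \<Rightarrow> ennreal) \<Rightarrow> ((real^'n) \<Rightarrow> complex) set" where
  "Lspace r w = {f. f \<in> borel_measurable lebesgue \<and> Lnorm r w (absfun f) < \<infinity>}"

section \<open>Generalized dyadic grids\<close>

text \<open>Cubes have sides parallel to the axes; any part of the boundary may be included.\<close>

definition cube_of_side :: "real \<Rightarrow> (real^'n) set \<Rightarrow> bool" where
  "cube_of_side l Q \<longleftrightarrow> l > 0 \<and>
     (\<exists>a I. (\<forall>i. {a $ i <..< a $ i + l} \<subseteq> I i \<and> I i \<subseteq> {a $ i .. a $ i + l}) \<and>
            Q = {x. \<forall>i. x $ i \<in> I i})"

definition side_length :: "(real^'n) set \<Rightarrow> real" where
  "side_length Q = (THE l. cube_of_side l Q)"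

definition dyadic_grid :: "(real^'n) set set \<Rightarrow> bool" where
  "dyadic_grid D \<longleftrightarrow>
     (\<forall>Q\<in>D. \<exists>k::int. cube_of_side (2 powi k) Q) \<and>
     (\<forall>Q\<in>D. \<forall>R\<in>D. Q \<inter> R \<noteq> {} \<longrightarrow> Q \<subseteq> R \<or> R \<subseteq> Q) \<and>
     (\<forall>k::int. partition_on UNIV {Q\<in>D. side_length Q = 2 powi (- k)})"

definition descendants :: "(real^'n) set set \<Rightarrow> nat \<Rightarrow> (real^'n) set \<Rightarrow> (real^'n) set set" where
  "descendants D j Q = {R\<in>D. R \<subseteq> Q \<and> side_length R = 2 powi (- int j) * side_length Q}"

definition dyadic_maximal ::
  "(real^'n) set set \<Rightarrow> ((real^'n) \<Rightarrow> complex) \<Rightarrow> (real^'n) \<Rightarrow> ennreal" where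
  "dyadic_maximal D f x =
     (SUP Q\<in>{Q\<in>D. x \<in> Q}. (\<integral>\<^sup>+y\<in>Q. ennreal (norm (f y)) \<partial>lebesgue) / emeasure lebesgue Q)"

definition maximal_bounded ::
  "(real^'n) set set \<Rightarrow> real \<Rightarrow> ((real^'n) \<Rightarrow> ennreal) \<Rightarrow> real \<Rightarrow> ((real^'n) \<Rightarrow> ennreal) \<Rightarrow> bool" where
  "maximal_bounded D r w1 s w2 \<longleftrightarrow>
     (\<exists>A::real. \<forall>f\<in>Lspace r w1.
        Lnorm s w2 (dyadic_maximal D f) \<le> ennreal A * Lnorm r w1 (absfun f))"

section \<open>Generalized Haar shift operators\<close>

definition gen_haar :: "(real^'n) set set \<Rightarrow> (real^'n) set \<Rightarrow> ((real^'n) \<Rightarrow> complex) \<Rightarrow> bool" where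
  "gen_haar D Q g \<longleftrightarrow>
     (\<forall>x. x \<notin> Q \<longrightarrow> g x = 0) \<and>
     (\<forall>Q'\<in>D. Q' \<subset> Q \<longrightarrow> (\<exists>c. \<forall>x\<in>Q'. g x = c)) \<and>
     (\<forall>x. norm (g x) \<le> 1)"

definition pairing :: "((real^'n) \<Rightarrow> complex) \<Rightarrow> ((real^'n) \<Rightarrow> complex) \<Rightarrow> complex" where
  "pairing f g = (\<integral>y. f y * cnj (g y) \<partial>lebesgue)"

text \<open>The function attached to \<open>Q'\<close> is \<open>g Q' Q''\<close>, the one attached to \<open>Q''\<close> is \<open>h Q'' Q'\<close>.
  Two families are used because for \<open>m = k\<close> the two functions are not meant to be linked
  when the roles of \<open>Q'\<close> and \<open>Q''\<close> are exchanged.\<close>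

type_synonym 'n haar_family = "(real^'n) set \<Rightarrow> (real^'n) set \<Rightarrow> (real^'n) \<Rightarrow> complex"

definition shift_piece ::
  "(real^'n) set set \<Rightarrow> nat \<Rightarrow> nat \<Rightarrow> 'n haar_family \<Rightarrow> 'n haar_family \<Rightarrow>
   (real^'n) set \<Rightarrow> ((real^'n) \<Rightarrow> complex) \<Rightarrow> (real^'n) \<Rightarrow> complex" where
  "shift_piece D m k g h Q f x =
     (\<Sum>Q'\<in>descendants D m Q. \<Sum>Q''\<in>descendants D k Q.
        pairing f (g Q' Q'') / of_real (measure lebesgue Q) * h Q'' Q' x)"

text \<open>At a given \<open>x\<close> only finitely many terms of the following sum are non-zero: those
  with \<open>x \<in> Q\<close>, one for each admissible side length. (The index set itself is infinite, so
  \<^const>\<open>sum\<close> is not applicable.)\<close>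

definition shift_trunc ::
  "(real^'n) set set \<Rightarrow> nat \<Rightarrow> nat \<Rightarrow> 'n haar_family \<Rightarrow> 'n haar_family \<Rightarrow>
   real \<Rightarrow> real \<Rightarrow> ((real^'n) \<Rightarrow> complex) \<Rightarrow> (real^'n) \<Rightarrow> complex" where
  "shift_trunc D m k g h e e' f x =
     (\<Sum>\<^sub>\<infinity>Q\<in>{Q\<in>D. e \<le> side_length Q \<and> side_length Q \<le> e'}. shift_piece D m k g h Q f x)"

text \<open>The full sum over \<open>D\<close> is the pointwise limit of its truncations as \<open>e \<rightarrow> 0\<close> and
  \<open>e' \<rightarrow> \<infinity>\<close>. The same formula defines the operator on every \<open>f\<close>, not only on \<open>L\<^sup>2\<close>;
  its value is meaningful where \<open>shift_converges\<close> holds.\<close>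

definition shift_converges ::
  "(real^'n) set set \<Rightarrow> nat \<Rightarrow> nat \<Rightarrow> 'n haar_family \<Rightarrow> 'n haar_family \<Rightarrow>
   ((real^'n) \<Rightarrow> complex) \<Rightarrow> (real^'n) \<Rightarrow> bool" where
  "shift_converges D m k g h f x \<longleftrightarrow>
     (\<exists>l. ((\<lambda>(e, e'). shift_trunc D m k g h e e' f x) \<longlongrightarrow> l) (at_right 0 \<times>\<^sub>F at_top))"

definition haar_shift ::
  "(real^'n) set set \<Rightarrow> nat \<Rightarrow> nat \<Rightarrow> 'n haar_family \<Rightarrow> 'n haar_family \<Rightarrow>
   ((real^'n) \<Rightarrow> complex) \<Rightarrow> (real^'n) \<Rightarrow> complex" where
  "haar_shift D m k g h f x =
     Lim (at_right 0 \<times>\<^sub>F at_top) (\<lambda>(e, e'). shift_trunc D m k g h e e' f x)"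

definition haar_shift_star ::
  "(real^'n) set set \<Rightarrow> nat \<Rightarrow> nat \<Rightarrow> 'n haar_family \<Rightarrow> 'n haar_family \<Rightarrow>
   ((real^'n) \<Rightarrow> complex) \<Rightarrow> (real^'n) \<Rightarrow> ennreal" where
  "haar_shift_star D m k g h f x =
     (SUP (e, e')\<in>{(e, e'). 0 < e \<and> e < e'}. ennreal (norm (shift_trunc D m k g h e e' f x)))"

definition shift_L2_bound ::
  "(real^'n) set set \<Rightarrow> nat \<Rightarrow> nat \<Rightarrow> 'n haar_family \<Rightarrow> 'n haar_family \<Rightarrow> real \<Rightarrow> bool" where
  "shift_L2_bound D m k g h B \<longleftrightarrow>
     (\<forall>f\<in>Lspace 2 (\<lambda>_. 1).
        Lnorm 2 (\<lambda>_. 1) (absfun (haar_shift D m k g h f))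
          \<le> ennreal B * Lnorm 2 (\<lambda>_. 1) (absfun f))"

definition gen_haar_shift ::
  "(real^'n) set set \<Rightarrow> nat \<Rightarrow> nat \<Rightarrow> 'n haar_family \<Rightarrow> 'n haar_family \<Rightarrow> bool" where
  "gen_haar_shift D m k g h \<longleftrightarrow>
     (\<forall>Q\<in>D. \<forall>Q'\<in>descendants D m Q. \<forall>Q''\<in>descendants D k Q.
        gen_haar D Q' (g Q' Q'') \<and> gen_haar D Q'' (h Q'' Q')) \<and>
     (\<forall>f\<in>Lspace 2 (\<lambda>_. 1). AE x in lebesgue. shift_converges D m k g h f x) \<and>
     (\<exists>B. shift_L2_bound D m k g h B)"

text \<open>For \<open>\<kappa> = 0\<close> the factor \<open>\<kappa>\<^sup>2\<close> of the estimates cannot be read literally, since it would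
  force the shift to vanish on the support of \<open>u\<close>, which is false already for
  \<open>f \<mapsto> \<langle>f, 1\<^sub>Q\<rangle> / |Q| * 1\<^sub>Q\<close> with a single cube \<open>Q\<close>; the estimates are therefore stated
  with \<open>max 1 \<kappa>\<close> instead.\<close>

definition shift_complexity :: "nat \<Rightarrow> nat \<Rightarrow> nat" where
  "shift_complexity m k = max m k"

end

theory Submission
  imports Defs
begin

text \<open>Each piece of the shift satisfies |S_Q f| \<le> <|f|>_Q 1_Q pointwise, and since p < q the positive
  operator T f = sum of <|f|>_Q 1_Q over \<^emph>\<open>all\<close> cubes Q of the grid is already bounded; no
  cancellation, and hence no dependence on the complexity or on the \<open>L\<^sup>2\<close> bound, enters.

  By duality one has to bound the sum of
  b(R) = (\<integral>_R |f|) (\<integral>_R g u) / |R| by a multiple of \<nu>(P)^(1/p) \<gamma>(P)^(1/q'), where R runs through cubes inside P,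
  \<nu>(R) = \<integral>_R |f|^p v and \<gamma>(R) = \<integral>_R g^q' u. Call R heavy in P if \<gamma>(R) > \<gamma>(P)/2. Two
  heavy cubes are never disjoint, so the heavy cubes form a chain, along which |R| at least doubles; the
  resulting geometric sum is controlled by pairings with the maximal functions of f and g u. The light
  cubes lie in disjoint maximal light cubes L, and because 1/p + 1/q' > 1, Hoelder's inequality and
  \<gamma>(L) \<le> \<gamma>(P)/2 give an induction with contraction factor 2^(1/q - 1/p) < 1. If g is an indicator
  function, then the masses \<integral>_R g u are comparable along the chain and the maximal function of g u alone
  suffices, which is the weak-type estimate.\<close>

section \<open>Powers of extended reals and the Hoelder inequality\<close>

text \<open>A grid has neither smallest nor largest cubes, so the recursion runs on finite
  subfamilies with a constant independent of the subfamily, and the whole space serves as a formal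
  root above their maximal cubes. A chain estimate has to return the masses of P, not those of the
  space: averages over R inside P do not change when f and g are cut off to P, so the global
  hypotheses are applied to the cut-off functions. Each generation of light cubes costs a factor r =
  2^(1/q - 1/p), whence the geometric sum C / (1 - r), which blows up as p tends to q. Returning
  from the bilinear estimate to T f means dividing by a power of the mass of g, which has to be
  finite beforehand. As u need not be locally integrable and T f might be infinite, test functions
  live on the sets \<open>level n\<close>, and for the strong type T f is also cut off at height n.
  The weak type estimate comes first because it shows that T f is finite a.e. where u > 0; this
  gives convergence of the shift series and lets the cut-off in the strong type estimate be
  removed.\<close>

lemma weighted_arith_geom:
  fixes a :: real
  assumes "0 < a" "a < 1" "0 \<le> x" "0 \<le> y"
  shows "x powr a * y powr (1 - a) \<le> a * x + (1 - a) * y"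
  using Youngs_inequality_0[of a "1 - a" x y] assms by (cases "x = 0 \<or> y = 0") auto

text \<open>After division by the two total sums, weighted AM-GM bounds every term, and the
  right-hand sides add up to a + (1 - a) = 1. It will be applied to the masses of disjoint
  cubes.\<close>

lemma sum_powr_Holder:
  fixes x y :: "'a \<Rightarrow> real"
  assumes "finite I" "\<And>i. i \<in> I \<Longrightarrow> 0 \<le> x i" "\<And>i. i \<in> I \<Longrightarrow> 0 \<le> y i" "0 < a" "a < 1"
  shows "(\<Sum>i\<in>I. x i powr a * y i powr (1 - a)) \<le> (\<Sum>i\<in>I. x i) powr a * (\<Sum>i\<in>I. y i) powr (1 - a)"
proof -
  define X Y where "X = (\<Sum>i\<in>I. x i)" and "Y = (\<Sum>i\<in>I. y i)"
  have XY: "X \<ge> 0" "Y \<ge> 0"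
    unfolding X_def Y_def using assms by (auto intro: sum_nonneg)
  show ?thesis
  proof (cases "X = 0 \<or> Y = 0")
    case True
    then have "\<forall>i\<in>I. x i = 0 \<or> y i = 0"
      using assms unfolding X_def Y_def by (auto simp: sum_nonneg_eq_0_iff)
    then have "(\<Sum>i\<in>I. x i powr a * y i powr (1 - a)) = 0"
      by (intro sum.neutral) auto
    then show ?thesis by simp
  next
    case False
    then have pos: "X > 0" "Y > 0" using XY by auto
    have "x i powr a * y i powr (1 - a) \<le> X powr a * Y powr (1 - a) * (a * (x i / X) + (1 - a) * (y i / Y))"
      if i: "i \<in> I" for i
    proof -
      have "(x i / X) powr a * (y i / Y) powr (1 - a) \<le> a * (x i / X) + (1 - a) * (y i / Y)"
        using assms i pos by (intro weighted_arith_geom) auto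
      then have "X powr a * Y powr (1 - a) * ((x i / X) powr a * (y i / Y) powr (1 - a))
          \<le> X powr a * Y powr (1 - a) * (a * (x i / X) + (1 - a) * (y i / Y))"
        by (intro mult_left_mono) auto
      moreover have "X powr a * Y powr (1 - a) * ((x i / X) powr a * (y i / Y) powr (1 - a))
          = x i powr a * y i powr (1 - a)"
        using assms i pos by (simp add: powr_divide)
      ultimately show ?thesis by simp
    qed
    then have "(\<Sum>i\<in>I. x i powr a * y i powr (1 - a))
        \<le> (\<Sum>i\<in>I. X powr a * Y powr (1 - a) * (a * (x i / X) + (1 - a) * (y i / Y)))"
      by (rule sum_mono)
    also have "\<dots> = X powr a * Y powr (1 - a) * (a * (\<Sum>i\<in>I. x i / X) + (1 - a) * (\<Sum>i\<in>I. y i / Y))"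
      by (simp only: sum.distrib sum_distrib_left[symmetric])
    also have "\<dots> = X powr a * Y powr (1 - a) * (a * (X / X) + (1 - a) * (Y / Y))"
      by (simp only: X_def Y_def sum_divide_distrib)
    also have "\<dots> = X powr a * Y powr (1 - a)"
      using pos by simp
    finally show ?thesis unfolding X_def Y_def .
  qed
qed

section \<open>Calculus of extended powers with positive exponents\<close>

lemma ennpowr_ennreal: "0 < a \<Longrightarrow> 0 \<le> r \<Longrightarrow> ennpowr (ennreal r) a = ennreal (r powr a)"
  by (auto simp: ennpowr_def ennreal_eq_0_iff)

lemma ennpowr_top: "0 < a \<Longrightarrow> ennpowr top a = top"
  by (simp add: ennpowr_def)

lemma ennpowr_zero: "0 < a \<Longrightarrow> ennpowr 0 a = 0"
  by (simp add: ennpowr_def)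

lemma ennpowr_mono: "0 < a \<Longrightarrow> x \<le> y \<Longrightarrow> ennpowr x a \<le> ennpowr y a"
  by (cases x; cases y) (auto simp: ennpowr_ennreal ennpowr_top top_unique intro!: ennreal_leI powr_mono2)

lemma ennpowr_one: "ennpowr x 1 = x"
  by (cases x) (auto simp: ennpowr_ennreal ennpowr_top)

lemma ennpowr_ennpowr: "0 < a \<Longrightarrow> 0 < b \<Longrightarrow> ennpowr (ennpowr x a) b = ennpowr x (a * b)"
  by (cases x) (auto simp: ennpowr_ennreal ennpowr_top powr_powr)

lemma ennpowr_eq_0_iff: "0 < a \<Longrightarrow> ennpowr x a = 0 \<longleftrightarrow> x = 0"
  by (cases x) (auto simp: ennpowr_ennreal ennpowr_top ennreal_eq_0_iff)

lemma ennpowr_eq_top_iff: "0 < a \<Longrightarrow> ennpowr x a = top \<longleftrightarrow> x = top"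
  by (cases x) (auto simp: ennpowr_ennreal ennpowr_top)

text \<open>Positivity of \<open>a\<close> is essential: for negative \<open>a\<close>,
  \<open>x = 0\<close> and \<open>y = top\<close> the left side is \<open>top\<close>, but the right
  side is \<open>top * 0 = 0\<close>. Negative powers of weights are therefore handled only where
  the weight lies strictly between 0 and \<open>top\<close>.\<close>

lemma ennpowr_mult:
  assumes "0 < a"
  shows "ennpowr (x * y) a = ennpowr x a * ennpowr y a"
proof -
  consider "x = 0 \<or> y = 0" | "x \<noteq> 0" "y \<noteq> 0" "x = top \<or> y = top" | "x \<noteq> top" "y \<noteq> top"
    by blast
  then show ?thesis
  proof cases
    case 1
    then show ?thesis using assms by (auto simp: ennpowr_zero)
  next
    case 2
    then have "x * y = top" by (auto simp: ennreal_top_mult ennreal_mult_top)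
    moreover have "ennpowr x a * ennpowr y a = top"
      using 2 assms ennpowr_eq_0_iff[OF assms, of x] ennpowr_eq_0_iff[OF assms, of y]
      by (auto simp: ennreal_top_mult ennreal_mult_top ennpowr_top)
    ultimately show ?thesis using assms by (simp add: ennpowr_top)
  next
    case 3
    then obtain r s where "x = ennreal r" "0 \<le> r" "y = ennreal s" "0 \<le> s"
      by (metis ennreal_cases)
    then show ?thesis
      using assms ennpowr_ennreal[OF assms, of "r * s"]
      by (simp add: ennpowr_ennreal ennreal_mult powr_mult)
  qed
qed

lemma measurable_ennpowr [measurable]:
  assumes "f \<in> borel_measurable M"
  shows "(\<lambda>x. ennpowr (f x) a) \<in> borel_measurable M"
  unfolding ennpowr_def using assms by measurable

text \<open>The exponents sit on the integrands and h is merely dominated a.e., so that a caller can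
  distribute a weight over F and G pointwise and discard a null set. If one of the two integrals is
  0, then h vanishes a.e., in accordance with \<open>0 * \<infinity> = 0\<close> on the
  right.\<close>

lemma nn_integral_Holder:
  assumes [measurable]: "F \<in> borel_measurable M" "G \<in> borel_measurable M"
    and a: "0 < a" "a < 1"
    and h: "AE x in M. h x \<le> ennpowr (F x) a * ennpowr (G x) (1 - a)"
  shows "(\<integral>\<^sup>+x. h x \<partial>M) \<le> ennpowr (\<integral>\<^sup>+x. F x \<partial>M) a * ennpowr (\<integral>\<^sup>+x. G x \<partial>M) (1 - a)"
proof (cases "(\<integral>\<^sup>+x. F x \<partial>M) = 0 \<or> (\<integral>\<^sup>+x. G x \<partial>M) = 0")
  case True
  then have "AE x in M. F x = 0 \<or> G x = 0"
    by (auto simp: nn_integral_0_iff_AE elim: eventually_mono)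
  with h have "AE x in M. h x = 0"
    by eventually_elim (use a in \<open>auto simp: ennpowr_zero\<close>)
  then have "(\<integral>\<^sup>+x. h x \<partial>M) = (\<integral>\<^sup>+x. 0 \<partial>M)"
    by (rule nn_integral_cong_AE)
  then show ?thesis by simp
next
  case nz: False
  show ?thesis
  proof (cases "(\<integral>\<^sup>+x. F x \<partial>M) = top \<or> (\<integral>\<^sup>+x. G x \<partial>M) = top")
    case True
    with nz a have "ennpowr (\<integral>\<^sup>+x. F x \<partial>M) a * ennpowr (\<integral>\<^sup>+x. G x \<partial>M) (1 - a) = top"
      by (auto simp: ennpowr_top ennreal_top_mult ennreal_mult_top ennpowr_eq_0_iff)
    then show ?thesis by simp
  next
    case False
    with nz obtain A B where A: "(\<integral>\<^sup>+x. F x \<partial>M) = ennreal A" "A > 0"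
      and B: "(\<integral>\<^sup>+x. G x \<partial>M) = ennreal B" "B > 0"
      by (metis ennreal_0 ennreal_cases less_eq_real_def)
    \<comment> \<open>K is the right-hand side; Young's inequality is rescaled so that its linear
      bound integrates to K a + K (1 - a) = K.\<close>
    define K where "K = A powr a * B powr (1 - a)"
    have K: "K \<ge> 0" by (simp add: K_def)
    have young: "ennpowr s a * ennpowr t (1 - a) \<le> ennreal (K * a / A) * s + ennreal (K * (1 - a) / B) * t"
      for s t :: ennreal
    proof (cases "s = top \<or> t = top")
      case True
      have "K * a / A > 0" "K * (1 - a) / B > 0"
        using a A B by (auto simp: K_def)
      with True show ?thesis by (auto simp: ennreal_mult_top)
    next
      case False
      then obtain s' t' where st: "s = ennreal s'" "0 \<le> s'" "t = ennreal t'" "0 \<le> t'"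
        by (metis ennreal_cases)
      have "(s' / A) powr a * (t' / B) powr (1 - a) \<le> a * (s' / A) + (1 - a) * (t' / B)"
        using a A B st by (intro weighted_arith_geom) auto
      then have "K * ((s' / A) powr a * (t' / B) powr (1 - a)) \<le> K * (a * (s' / A) + (1 - a) * (t' / B))"
        using K by (rule mult_left_mono)
      moreover have "K * ((s' / A) powr a * (t' / B) powr (1 - a)) = s' powr a * t' powr (1 - a)"
        using A B st by (simp add: powr_divide K_def)
      ultimately have "s' powr a * t' powr (1 - a) \<le> K * a / A * s' + K * (1 - a) / B * t'"
        by (simp add: algebra_simps)
      then show ?thesis
        using st a A B K by (simp add: ennpowr_ennreal flip: ennreal_mult ennreal_plus)
    qed
    have "(\<integral>\<^sup>+x. h x \<partial>M) \<le> (\<integral>\<^sup>+x. ennreal (K * a / A) * F x + ennreal (K * (1 - a) / B) * G x \<partial>M)"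
      using h by (intro nn_integral_mono_AE) (auto elim!: eventually_mono intro: order_trans young)
    also have "\<dots> = ennreal (K * a / A) * ennreal A + ennreal (K * (1 - a) / B) * ennreal B"
      by (simp add: nn_integral_add nn_integral_cmult A B)
    also have "\<dots> = ennreal K"
      using A B a K by (simp flip: ennreal_mult ennreal_plus) (simp add: algebra_simps)
    also have "\<dots> = ennpowr (\<integral>\<^sup>+x. F x \<partial>M) a * ennpowr (\<integral>\<^sup>+x. G x \<partial>M) (1 - a)"
      using A B a by (simp add: ennpowr_ennreal K_def ennreal_mult)
    finally show ?thesis .
  qed
qed

section \<open>Summation over a laminar family\<close>

text \<open>The empty set is excluded because it would lie below each of two disjoint maximal sets
  and be counted twice when a sum is split along them.\<close>

definition laminar :: "'a set set \<Rightarrow> bool" where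
  "laminar D \<longleftrightarrow> {} \<notin> D \<and> (\<forall>Q\<in>D. \<forall>R\<in>D. Q \<inter> R \<noteq> {} \<longrightarrow> Q \<subseteq> R \<or> R \<subseteq> Q)"

definition nested :: "'a set set \<Rightarrow> bool" where
  "nested C \<longleftrightarrow> (\<forall>Q\<in>C. \<forall>R\<in>C. Q \<subseteq> R \<or> R \<subseteq> Q)"

definition maximal_sets :: "'a set set \<Rightarrow> 'a set set" where
  "maximal_sets S = {L\<in>S. \<forall>R\<in>S. L \<subseteq> R \<longrightarrow> L = R}"

lemma maximal_sets_superset:
  assumes "finite S" "R \<in> S"
  obtains L where "L \<in> maximal_sets S" "R \<subseteq> L"
  using finite_has_maximal2[OF assms] unfolding maximal_sets_def by blast

lemma disjoint_maximal_sets: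
  assumes "laminar D" "S \<subseteq> D"
  shows "disjoint (maximal_sets S)"
  unfolding disjoint_def
proof (intro ballI impI)
  fix Q R assume *: "Q \<in> maximal_sets S" "R \<in> maximal_sets S" "Q \<noteq> R"
  then have "Q \<in> D" "R \<in> D" "\<not> Q \<subseteq> R" "\<not> R \<subseteq> Q"
    using assms(2) unfolding maximal_sets_def by auto
  then show "Q \<inter> R = {}" using assms(1) unfolding laminar_def by blast
qed

text \<open>Each member of S lies below some maximal one because S is finite, and below only one
  because maximal members are disjoint and members are nonempty.\<close>

lemma sum_maximal_sets:
  fixes b :: "'a set \<Rightarrow> 'b::comm_monoid_add"
  assumes "laminar D" "S \<subseteq> D" "finite S"
  shows "sum b S = (\<Sum>L\<in>maximal_sets S. \<Sum>R\<in>{R\<in>S. R \<subseteq> L}. b R)"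
proof -
  have "S = (\<Union>L\<in>maximal_sets S. {R\<in>S. R \<subseteq> L})"
    using maximal_sets_superset[OF assms(3)] by blast
  moreover have "sum b (\<Union>L\<in>maximal_sets S. {R\<in>S. R \<subseteq> L}) = (\<Sum>L\<in>maximal_sets S. \<Sum>R\<in>{R\<in>S. R \<subseteq> L}. b R)"
  proof (rule sum.UNION_disjoint)
    show "finite (maximal_sets S)" using assms(3) by (simp add: maximal_sets_def)
    show "\<forall>L\<in>maximal_sets S. finite {R \<in> S. R \<subseteq> L}" using assms(3) by simp
    show "\<forall>i\<in>maximal_sets S. \<forall>j\<in>maximal_sets S. i \<noteq> j \<longrightarrow> {R \<in> S. R \<subseteq> i} \<inter> {R \<in> S. R \<subseteq> j} = {}"
    proof (intro ballI impI)
      fix i j assume "i \<in> maximal_sets S" "j \<in> maximal_sets S" "i \<noteq> j"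
      then have "i \<inter> j = {}"
        using disjoint_maximal_sets[OF assms(1,2)] unfolding disjoint_def by auto
      moreover have "{} \<notin> S" using assms(1,2) unfolding laminar_def by auto
      ultimately show "{R \<in> S. R \<subseteq> i} \<inter> {R \<in> S. R \<subseteq> j} = {}"
        by (auto simp: disjoint_iff) (metis disjoint_iff subset_empty subset_iff equals0I)
    qed
  qed
  ultimately show ?thesis by metis
qed

locale tree_bound =
  fixes D :: "'a set set" and \<nu> \<gamma> :: "'a set \<Rightarrow> real" and b :: "'a set \<Rightarrow> ennreal" and \<alpha> \<beta> C :: real
  assumes laminar: "laminar D"
    and exponents: "0 < \<alpha>" "\<alpha> < 1" "1 < \<alpha> + \<beta>"
    and C_nonneg: "0 \<le> C"
    and nonneg: "\<And>X. 0 \<le> \<nu> X" "\<And>X. 0 \<le> \<gamma> X"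
    and superadditive:
      "\<And>L X. finite L \<Longrightarrow> L \<subseteq> D \<Longrightarrow> disjoint L \<Longrightarrow> \<Union>L \<subseteq> X \<Longrightarrow> X \<in> insert UNIV D \<Longrightarrow> sum \<nu> L \<le> \<nu> X"
      "\<And>L X. finite L \<Longrightarrow> L \<subseteq> D \<Longrightarrow> disjoint L \<Longrightarrow> \<Union>L \<subseteq> X \<Longrightarrow> X \<in> insert UNIV D \<Longrightarrow> sum \<gamma> L \<le> \<gamma> X"
    and null: "\<And>R. R \<in> D \<Longrightarrow> \<gamma> R = 0 \<Longrightarrow> b R = 0"
    and heavy_chain:
      "\<And>P S. P \<in> D \<Longrightarrow> finite S \<Longrightarrow> S \<subseteq> D \<Longrightarrow> nested S \<Longrightarrow> (\<And>R. R \<in> S \<Longrightarrow> R \<subseteq> P \<and> \<gamma> P / 2 < \<gamma> R) \<Longrightarrow>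
         sum b S \<le> ennreal (C * \<nu> P powr \<alpha> * \<gamma> P powr \<beta>)"
begin

text \<open>Sum of the geometric series with first term C and ratio 2^-(\<alpha> + \<beta> - 1),
  that is, the fixed point of t = C + ratio * t. It is the constant that the induction
  reproduces.\<close>

definition "tree_const = C / (1 - 2 powr - (\<alpha> + \<beta> - 1))"

lemma ratio_less_1: "2 powr - (\<alpha> + \<beta> - 1) < (1::real)"
  using exponents powr_less_one[of 2 "- (\<alpha> + \<beta> - 1)"] by simp

lemma tree_const_nonneg: "0 \<le> tree_const"
  unfolding tree_const_def using C_nonneg ratio_less_1 by simp

lemma tree_const_eq: "C + tree_const * 2 powr - (\<alpha> + \<beta> - 1) = tree_const"
proof -
  have "c + c / (1 - x) * x = c / (1 - x)" if "x < 1" for c x :: real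
    using that by (simp add: field_simps)
  then show ?thesis unfolding tree_const_def using ratio_less_1 by blast
qed

text \<open>Split \<gamma>^\<beta> into \<gamma>^(\<alpha> + \<beta> - 1) and \<gamma>^(1 -
  \<alpha>). The surplus exponent is positive, so the first factor is at most the corresponding
  power of c; what remains has Hoelder exponents \<alpha> and 1 - \<alpha>. This is where the gap p
  < q is exploited.\<close>

lemma sum_disjoint_le:
  assumes L: "finite L" "L \<subseteq> D" "disjoint L" "\<Union>L \<subseteq> X" "X \<in> insert UNIV D"
    and c: "\<And>R. R \<in> L \<Longrightarrow> \<gamma> R \<le> c"
  shows "(\<Sum>R\<in>L. \<nu> R powr \<alpha> * \<gamma> R powr \<beta>) \<le> c powr (\<alpha> + \<beta> - 1) * (\<nu> X powr \<alpha> * \<gamma> X powr (1 - \<alpha>))"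
proof -
  have "\<nu> R powr \<alpha> * \<gamma> R powr \<beta> \<le> c powr (\<alpha> + \<beta> - 1) * (\<nu> R powr \<alpha> * \<gamma> R powr (1 - \<alpha>))" if "R \<in> L" for R
  proof -
    have "\<gamma> R powr \<beta> = \<gamma> R powr (\<alpha> + \<beta> - 1) * \<gamma> R powr (1 - \<alpha>)"
      by (simp flip: powr_add)
    also have "\<dots> \<le> c powr (\<alpha> + \<beta> - 1) * \<gamma> R powr (1 - \<alpha>)"
      using c[OF that] nonneg exponents by (intro mult_right_mono powr_mono2) auto
    finally show ?thesis
      by (metis mult.left_commute mult_left_mono powr_ge_zero)
  qed
  then have "(\<Sum>R\<in>L. \<nu> R powr \<alpha> * \<gamma> R powr \<beta>) \<le> (\<Sum>R\<in>L. c powr (\<alpha> + \<beta> - 1) * (\<nu> R powr \<alpha> * \<gamma> R powr (1 - \<alpha>)))"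
    by (rule sum_mono)
  also have "\<dots> = c powr (\<alpha> + \<beta> - 1) * (\<Sum>R\<in>L. \<nu> R powr \<alpha> * \<gamma> R powr (1 - \<alpha>))"
    by (simp add: sum_distrib_left)
  also have "\<dots> \<le> c powr (\<alpha> + \<beta> - 1) * (sum \<nu> L powr \<alpha> * sum \<gamma> L powr (1 - \<alpha>))"
    using L nonneg exponents by (intro mult_left_mono sum_powr_Holder) auto
  also have "\<dots> \<le> c powr (\<alpha> + \<beta> - 1) * (\<nu> X powr \<alpha> * \<gamma> X powr (1 - \<alpha>))"
    using superadditive[OF L] nonneg exponents
    by (intro mult_left_mono mult_mono powr_mono2) (auto intro: sum_nonneg)
  finally show ?thesis .
qed

lemma mono_gamma: "R \<in> D \<Longrightarrow> P \<in> D \<Longrightarrow> R \<subseteq> P \<Longrightarrow> \<gamma> R \<le> \<gamma> P"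
  using superadditive(2)[of "{R}" P] by (simp add: disjoint_def)

text \<open>A set P of positive mass is heavy in itself, so the members below a maximal light set L
  form a strictly smaller family with top L, and induction on the cardinality applies to
  them.\<close>

lemma tree_bound_top:
  assumes "finite S" "S \<subseteq> D" "P \<in> S" "\<And>R. R \<in> S \<Longrightarrow> R \<subseteq> P"
  shows "sum b S \<le> ennreal (tree_const * \<nu> P powr \<alpha> * \<gamma> P powr \<beta>)"
  using assms
proof (induction "card S" arbitrary: S P rule: less_induct)
  case less
  show ?case
  proof (cases "\<gamma> P = 0")
    case True
    have "b R = 0" if "R \<in> S" for R
    proof (rule null)
      show "\<gamma> R = 0"
        using that less.prems nonneg mono_gamma[of R P] True by (metis order_antisym subsetD)
    qed (use that less.prems in auto)
    then show ?thesis by simp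
  next
    case False
    then have pos: "\<gamma> P > 0" using nonneg[of P] by linarith
    define H where "H = {R\<in>S. \<gamma> P / 2 < \<gamma> R}"
    define S' where "S' = S - H"
    have PD: "P \<in> D" using less.prems by auto
    have S': "finite S'" "S' \<subseteq> D" "S' \<subseteq> S" and P: "P \<in> H"
      using less.prems pos unfolding S'_def H_def by auto
    have max: "L \<in> S'" if "L \<in> maximal_sets S'" for L
      using that by (simp add: maximal_sets_def)
    have "nested H"
      unfolding nested_def
    proof (intro ballI)
      fix Q R assume QR: "Q \<in> H" "R \<in> H"
      show "Q \<subseteq> R \<or> R \<subseteq> Q"
      proof (rule ccontr)
        assume n: "\<not> ?thesis"
        have "Q \<in> D" "R \<in> D" "Q \<subseteq> P" "R \<subseteq> P"
          using QR less.prems unfolding H_def by auto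
        moreover from this n have "Q \<inter> R = {}" "Q \<noteq> R"
          using laminar unfolding laminar_def by blast+
        ultimately have "sum \<gamma> {Q, R} \<le> \<gamma> P"
          using PD by (intro superadditive(2)) (auto simp: disjoint_def)
        then show False using \<open>Q \<noteq> R\<close> QR unfolding H_def by auto
      qed
    qed
    then have H: "sum b H \<le> ennreal (C * \<nu> P powr \<alpha> * \<gamma> P powr \<beta>)"
      using less.prems PD by (intro heavy_chain) (auto simp: H_def)
    have light: "(\<Sum>R\<in>{R\<in>S'. R \<subseteq> L}. b R) \<le> ennreal (tree_const * \<nu> L powr \<alpha> * \<gamma> L powr \<beta>)"
      if "L \<in> maximal_sets S'" for L
    proof (rule less.hyps)
      have "{R \<in> S'. R \<subseteq> L} \<subset> S" using P less.prems unfolding S'_def by blast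
      then show "card {R \<in> S'. R \<subseteq> L} < card S" using less.prems(1) psubset_card_mono by blast
    qed (use S' max[OF that] in auto)
    have "sum b S' = (\<Sum>L\<in>maximal_sets S'. \<Sum>R\<in>{R\<in>S'. R \<subseteq> L}. b R)"
      by (rule sum_maximal_sets[OF laminar S'(2,1)])
    also have "\<dots> \<le> (\<Sum>L\<in>maximal_sets S'. ennreal (tree_const * (\<nu> L powr \<alpha> * \<gamma> L powr \<beta>)))"
      using light by (intro sum_mono) (simp add: mult.assoc)
    also have "\<dots> = ennreal (tree_const * (\<Sum>L\<in>maximal_sets S'. \<nu> L powr \<alpha> * \<gamma> L powr \<beta>))"
      using tree_const_nonneg by (simp add: sum_distrib_left)
    also have "\<dots> \<le> ennreal (tree_const * ((\<gamma> P / 2) powr (\<alpha> + \<beta> - 1) * (\<nu> P powr \<alpha> * \<gamma> P powr (1 - \<alpha>))))"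
    proof (intro ennreal_leI mult_left_mono tree_const_nonneg sum_disjoint_le)
      show "finite (maximal_sets S')" "maximal_sets S' \<subseteq> D"
        using S' by (auto simp: maximal_sets_def)
      show "\<Union>(maximal_sets S') \<subseteq> P"
        using S'(3) max less.prems(4) by (meson Sup_least subsetD)
      show "disjoint (maximal_sets S')" by (rule disjoint_maximal_sets[OF laminar S'(2)])
      show "\<gamma> R \<le> \<gamma> P / 2" if "R \<in> maximal_sets S'" for R
        using max[OF that] unfolding S'_def H_def by auto
    qed (use PD in simp)
    \<comment> \<open>The exponents \<alpha> + \<beta> - 1 and 1 - \<alpha> recombine to \<beta>;
      the halving of the mass leaves exactly the contraction factor of
      \<open>tree_const_eq\<close>.\<close>
    also have "(\<gamma> P / 2) powr (\<alpha> + \<beta> - 1) * (\<nu> P powr \<alpha> * \<gamma> P powr (1 - \<alpha>))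
        = 2 powr - (\<alpha> + \<beta> - 1) * (\<nu> P powr \<alpha> * \<gamma> P powr \<beta>)"
      using pos by (simp add: powr_divide powr_minus field_simps flip: powr_add)
    finally have light_sum: "sum b S' \<le> ennreal (tree_const * (2 powr - (\<alpha> + \<beta> - 1) * (\<nu> P powr \<alpha> * \<gamma> P powr \<beta>)))" .
    have "sum b S = sum b H + sum b S'"
      unfolding S'_def H_def using less.prems(1) by (subst sum.subset_diff[of "{R \<in> S. \<gamma> P / 2 < \<gamma> R}" S]) (auto simp: add.commute)
    also have "\<dots> \<le> ennreal (C * \<nu> P powr \<alpha> * \<gamma> P powr \<beta>)
        + ennreal (tree_const * (2 powr - (\<alpha> + \<beta> - 1) * (\<nu> P powr \<alpha> * \<gamma> P powr \<beta>)))"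
      using H light_sum by (rule add_mono)
    also have "\<dots> = ennreal ((C + tree_const * 2 powr - (\<alpha> + \<beta> - 1)) * \<nu> P powr \<alpha> * \<gamma> P powr \<beta>)"
      using C_nonneg tree_const_nonneg by (subst ennreal_plus[symmetric]) (auto simp: algebra_simps)
    finally show ?thesis by (simp only: tree_const_eq)
  qed
qed

text \<open>The maximal members now play the role of the light sets below the root
  \<open>UNIV\<close>. With c = \<gamma> UNIV nothing is halved, but nothing heavy has to be added
  either, so the constant stays \<open>tree_const\<close>.\<close>

theorem tree_bound:
  assumes "finite S" "S \<subseteq> D"
  shows "sum b S \<le> ennreal (tree_const * \<nu> UNIV powr \<alpha> * \<gamma> UNIV powr \<beta>)"
proof -
  have max: "L \<in> S" if "L \<in> maximal_sets S" for L
    using that by (simp add: maximal_sets_def)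
  have sub: "\<gamma> L \<le> \<gamma> UNIV" if "L \<in> D" for L
    using superadditive(2)[of "{L}" UNIV] that by (simp add: disjoint_def)
  have "sum b S = (\<Sum>L\<in>maximal_sets S. \<Sum>R\<in>{R\<in>S. R \<subseteq> L}. b R)"
    by (rule sum_maximal_sets[OF laminar assms(2,1)])
  also have "\<dots> \<le> (\<Sum>L\<in>maximal_sets S. ennreal (tree_const * (\<nu> L powr \<alpha> * \<gamma> L powr \<beta>)))"
  proof (rule sum_mono)
    fix L assume "L \<in> maximal_sets S"
    then have "(\<Sum>R\<in>{R\<in>S. R \<subseteq> L}. b R) \<le> ennreal (tree_const * \<nu> L powr \<alpha> * \<gamma> L powr \<beta>)"
      using assms max by (intro tree_bound_top) auto
    then show "(\<Sum>R\<in>{R\<in>S. R \<subseteq> L}. b R) \<le> ennreal (tree_const * (\<nu> L powr \<alpha> * \<gamma> L powr \<beta>))"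
      by (simp add: mult.assoc)
  qed
  also have "\<dots> = ennreal (tree_const * (\<Sum>L\<in>maximal_sets S. \<nu> L powr \<alpha> * \<gamma> L powr \<beta>))"
    using tree_const_nonneg by (simp add: sum_distrib_left)
  also have "\<dots> \<le> ennreal (tree_const * (\<gamma> UNIV powr (\<alpha> + \<beta> - 1) * (\<nu> UNIV powr \<alpha> * \<gamma> UNIV powr (1 - \<alpha>))))"
    using assms max sub laminar
    by (intro ennreal_leI mult_left_mono tree_const_nonneg sum_disjoint_le disjoint_maximal_sets)
      (auto simp: maximal_sets_def)
  also have "\<gamma> UNIV powr (\<alpha> + \<beta> - 1) * (\<nu> UNIV powr \<alpha> * \<gamma> UNIV powr (1 - \<alpha>)) = \<nu> UNIV powr \<alpha> * \<gamma> UNIV powr \<beta>"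
    by (simp add: field_simps flip: powr_add)
  finally show ?thesis by (simp add: mult.assoc)
qed

end

section \<open>Chains of sets of geometrically growing measure\<close>

lemma nested_has_top:
  assumes "finite C" "C \<noteq> {}" "nested C"
  obtains P where "P \<in> C" "\<And>R. R \<in> C \<Longrightarrow> R \<subseteq> P"
proof -
  obtain P where P: "P \<in> C" "\<forall>R\<in>C. P \<subseteq> R \<longrightarrow> P = R"
    using finite_has_maximal[OF assms(1,2)] by auto
  have "R \<subseteq> P" if "R \<in> C" for R
    using assms(3) P that unfolding nested_def by (metis order_refl)
  then show ?thesis using that P(1) by metis
qed

lemma ennreal_double_divide:
  fixes r r' :: ennreal
  assumes "0 < r'" "2 * r' \<le> r"
  shows "2 * (x / r) \<le> x / r'"
proof -
  have "2 * inverse r \<le> inverse r'"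
  proof (cases r)
    case (real s)
    then obtain s' where s': "r' = ennreal s'" "0 \<le> s'"
      using assms by (cases r') (auto simp: top_unique ennreal_mult_top)
    have "0 < s'" "2 * s' \<le> s"
      using assms s' real by (auto simp flip: ennreal_mult ennreal_numeral)
    then show ?thesis using s' real
      by (auto simp: inverse_ennreal field_simps simp flip: ennreal_mult ennreal_numeral intro!: ennreal_leI)
  qed auto
  then have "x * (2 * inverse r) \<le> x * inverse r'" by (rule mult_left_mono) simp
  then show ?thesis by (simp add: divide_ennreal_def mult_ac)
qed

text \<open>Doubling makes the values c / |R|, over the members R containing a given point, a
  geometric sum: it is at most twice the term of the smallest such member. The two chain estimates
  are integrated forms of this fact.\<close>

locale geometric_chain =
  fixes M :: "'a measure" and S :: "'a set set"
  assumes finite: "finite S" and nested: "nested S"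
    and sets: "\<And>R. R \<in> S \<Longrightarrow> R \<in> sets M"
    and pos: "\<And>R. R \<in> S \<Longrightarrow> 0 < emeasure M R"
    and doubling: "\<And>R R'. R \<in> S \<Longrightarrow> R' \<in> S \<Longrightarrow> R \<subset> R' \<Longrightarrow> 2 * emeasure M R \<le> emeasure M R'"

lemma geometric_chain_subset: "geometric_chain M S \<Longrightarrow> S' \<subseteq> S \<Longrightarrow> geometric_chain M S'"
  unfolding geometric_chain_def nested_def by (meson finite_subset subsetD)

lemma set_nn_integral_split:
  assumes "f \<in> borel_measurable M" "A \<in> sets M" "B \<in> sets M" "B \<subseteq> A"
  shows "(\<integral>\<^sup>+x\<in>A. f x \<partial>M) = (\<integral>\<^sup>+x\<in>A - B. f x \<partial>M) + (\<integral>\<^sup>+x\<in>B. f x \<partial>M)"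
proof -
  have [measurable]: "f \<in> borel_measurable M" "A \<in> sets M" "B \<in> sets M" using assms by auto
  have "(\<integral>\<^sup>+x\<in>A. f x \<partial>M) = (\<integral>\<^sup>+x. f x * indicator (A - B) x + f x * indicator B x \<partial>M)"
    using assms(4) by (intro nn_integral_cong) (auto split: split_indicator)
  then show ?thesis by (simp add: nn_integral_add)
qed

lemma set_nn_integral_mult_le:
  assumes "f \<in> borel_measurable M" "A \<in> sets M" "\<And>x. x \<in> A \<Longrightarrow> c \<le> g x"
  shows "(\<integral>\<^sup>+x\<in>A. f x \<partial>M) * c \<le> (\<integral>\<^sup>+x\<in>A. f x * g x \<partial>M)"
proof -
  have [measurable]: "f \<in> borel_measurable M" "A \<in> sets M" using assms by auto
  have "(\<integral>\<^sup>+x\<in>A. f x \<partial>M) * c = (\<integral>\<^sup>+x. f x * indicator A x * c \<partial>M)"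
    by (rule nn_integral_multc[symmetric]) measurable
  also have "\<dots> \<le> (\<integral>\<^sup>+x\<in>A. f x * g x \<partial>M)"
    using assms(3) by (intro nn_integral_mono) (auto split: split_indicator intro: mult_left_mono)
  finally show ?thesis .
qed

text \<open>In the next two lemmas the extra summand for the largest set P makes the induction close: if P' is
  the second largest set, the part of it that comes from P' is at most half of the summand for P',
  because the measure of P is at least twice that of P'.\<close>

lemma chain_kernel_bound:
  assumes S: "geometric_chain M S" and P: "P \<in> S" "\<And>R. R \<in> S \<Longrightarrow> R \<subseteq> P"
    and [measurable]: "f \<in> borel_measurable M" "k \<in> borel_measurable M"
    and k: "\<And>R x. R \<in> S \<Longrightarrow> x \<in> R \<Longrightarrow> c / emeasure M R \<le> k x"
  shows "(\<Sum>R\<in>S. (\<integral>\<^sup>+x\<in>R. f x \<partial>M) * c / emeasure M R) + (\<integral>\<^sup>+x\<in>P. f x \<partial>M) * c / emeasure M P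
      \<le> 2 * (\<integral>\<^sup>+x\<in>P. f x * k x \<partial>M)"
  using S P k
proof (induction "card S" arbitrary: S P rule: less_induct)
  case less
  interpret geometric_chain M S by fact
  let ?a = "\<lambda>R. \<integral>\<^sup>+x\<in>R. f x \<partial>M" and ?r = "emeasure M" and ?I = "\<lambda>A. \<integral>\<^sup>+x\<in>A. f x * k x \<partial>M"
  define S' where "S' = S - {P}"
  have Pm: "P \<in> sets M" using sets less.prems by auto
  \<comment> \<open>Every point of A lies in P, so k is at least c / |P| throughout A.\<close>
  have shell: "?a A * c / ?r P \<le> ?I A" if "A \<in> sets M" "A \<subseteq> P" for A
    using set_nn_integral_mult_le[of f M A "c / ?r P" k] that less.prems(2,4)
    by (auto simp: divide_ennreal_def mult.assoc)
  have sum: "(\<Sum>R\<in>S. ?a R * c / ?r R) + ?a P * c / ?r P = (\<Sum>R\<in>S'. ?a R * c / ?r R) + 2 * (?a P * c / ?r P)"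
    unfolding S'_def using finite less.prems(2) by (simp add: sum.remove mult_2 ac_simps)
  show ?case
  proof (cases "S' = {}")
    case True
    then show ?thesis unfolding sum using shell[OF Pm] by (simp add: mult_left_mono)
  next
    case False
    have ch: "geometric_chain M S'"
      using less.prems(1) by (rule geometric_chain_subset) (auto simp: S'_def)
    obtain P' where P': "P' \<in> S'" "\<And>R. R \<in> S' \<Longrightarrow> R \<subseteq> P'"
      using nested_has_top[of S'] ch False unfolding geometric_chain_def by metis
    have P'm [measurable]: "P' \<in> sets M" and sub: "P' \<subset> P" and P'S: "P' \<in> S"
      using P' less.prems sets unfolding S'_def by auto
    have "card S' < card S"
      unfolding S'_def using finite less.prems(2) by (intro card_Diff1_less)
    then have IH: "(\<Sum>R\<in>S'. ?a R * c / ?r R) + ?a P' * c / ?r P' \<le> 2 * ?I P'"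
      using ch P' less.prems(4) by (intro less.hyps) (auto simp: S'_def)
    have "?a P * c / ?r P = ?a (P - P') * c / ?r P + ?a P' * c / ?r P"
      using set_nn_integral_split[of f M P P'] Pm sub by (simp add: add_divide_distrib_ennreal distrib_right)
    then have "2 * (?a P * c / ?r P) = 2 * (?a (P - P') * c / ?r P) + 2 * (?a P' * c / ?r P)"
      by (simp add: distrib_left)
    also have "\<dots> \<le> 2 * ?I (P - P') + ?a P' * c / ?r P'"
      using shell[of "P - P'"] Pm pos[OF P'S] doubling[OF P'S less.prems(2) sub]
      by (intro add_mono mult_left_mono ennreal_double_divide) auto
    finally have "(\<Sum>R\<in>S'. ?a R * c / ?r R) + 2 * (?a P * c / ?r P)
        \<le> (\<Sum>R\<in>S'. ?a R * c / ?r R) + (2 * ?I (P - P') + ?a P' * c / ?r P')"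
      by (rule add_left_mono)
    also have "\<dots> = 2 * ?I (P - P') + ((\<Sum>R\<in>S'. ?a R * c / ?r R) + ?a P' * c / ?r P')"
      by (simp add: ac_simps)
    also have "\<dots> \<le> 2 * ?I (P - P') + 2 * ?I P'"
      using IH by (rule add_left_mono)
    also have "\<dots> = 2 * ?I P"
      using set_nn_integral_split[of "\<lambda>x. f x * k x" M P P'] Pm sub by (simp add: distrib_left)
    finally show ?thesis unfolding sum .
  qed
qed

lemma chain_product_bound:
  assumes S: "geometric_chain M S" and P: "P \<in> S" "\<And>R. R \<in> S \<Longrightarrow> R \<subseteq> P"
    and [measurable]: "f \<in> borel_measurable M" "Mf \<in> borel_measurable M"
      "g \<in> borel_measurable M" "Mg \<in> borel_measurable M"
    and Mf: "\<And>R x. R \<in> S \<Longrightarrow> x \<in> R \<Longrightarrow> (\<integral>\<^sup>+x\<in>R. f x \<partial>M) / emeasure M R \<le> Mf x"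
    and Mg: "\<And>R x. R \<in> S \<Longrightarrow> x \<in> R \<Longrightarrow> (\<integral>\<^sup>+x\<in>R. g x \<partial>M) / emeasure M R \<le> Mg x"
  shows "(\<Sum>R\<in>S. (\<integral>\<^sup>+x\<in>R. f x \<partial>M) * (\<integral>\<^sup>+x\<in>R. g x \<partial>M) / emeasure M R)
        + (\<integral>\<^sup>+x\<in>P. f x \<partial>M) * (\<integral>\<^sup>+x\<in>P. g x \<partial>M) / emeasure M P
      \<le> 2 * (\<integral>\<^sup>+x\<in>P. f x * Mg x + g x * Mf x \<partial>M)"
  using S P Mf Mg
proof (induction "card S" arbitrary: S P rule: less_induct)
  case less
  interpret geometric_chain M S by fact
  let ?a = "\<lambda>R. \<integral>\<^sup>+x\<in>R. f x \<partial>M" and ?c = "\<lambda>R. \<integral>\<^sup>+x\<in>R. g x \<partial>M" and ?r = "emeasure M"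
    and ?I = "\<lambda>A. \<integral>\<^sup>+x\<in>A. f x * Mg x + g x * Mf x \<partial>M"
  define S' where "S' = S - {P}"
  have Pm: "P \<in> sets M" using sets less.prems by auto
  have shell: "?a A * ?c P / ?r P + ?a P * ?c A / ?r P \<le> ?I A" if [measurable]: "A \<in> sets M" and "A \<subseteq> P" for A
  proof -
    have "?a A * (?c P / ?r P) \<le> (\<integral>\<^sup>+x\<in>A. f x * Mg x \<partial>M)"
      using that(2) less.prems(2,5) by (intro set_nn_integral_mult_le) auto
    moreover have "?c A * (?a P / ?r P) \<le> (\<integral>\<^sup>+x\<in>A. g x * Mf x \<partial>M)"
      using that(2) less.prems(2,4) by (intro set_nn_integral_mult_le) auto
    moreover have "?I A = (\<integral>\<^sup>+x\<in>A. f x * Mg x \<partial>M) + (\<integral>\<^sup>+x\<in>A. g x * Mf x \<partial>M)"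
      by (subst nn_integral_add[symmetric]) (auto intro!: nn_integral_cong simp: distrib_right)
    ultimately show ?thesis by (simp add: divide_ennreal_def mult_ac add_mono)
  qed
  have sum: "(\<Sum>R\<in>S. ?a R * ?c R / ?r R) + ?a P * ?c P / ?r P = (\<Sum>R\<in>S'. ?a R * ?c R / ?r R) + 2 * (?a P * ?c P / ?r P)"
    unfolding S'_def using finite less.prems(2) by (simp add: sum.remove mult_2 ac_simps)
  show ?case
  proof (cases "S' = {}")
    case True
    \<comment> \<open>For A = P the two products in \<open>shell\<close> coincide, which supplies
      the factor 2.\<close>
    have "2 * (?a P * ?c P / ?r P) \<le> ?I P" using shell[OF Pm] by (simp add: mult_2)
    also have "\<dots> \<le> 2 * ?I P" by (simp add: mult_2)
    finally show ?thesis unfolding sum True by simp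
  next
    case False
    have ch: "geometric_chain M S'"
      using less.prems(1) by (rule geometric_chain_subset) (auto simp: S'_def)
    obtain P' where P': "P' \<in> S'" "\<And>R. R \<in> S' \<Longrightarrow> R \<subseteq> P'"
      using nested_has_top[of S'] ch False unfolding geometric_chain_def by metis
    have P'm [measurable]: "P' \<in> sets M" and sub: "P' \<subset> P" and P'S: "P' \<in> S"
      using P' less.prems sets unfolding S'_def by auto
    have "card S' < card S"
      unfolding S'_def using finite less.prems(2) by (intro card_Diff1_less)
    then have IH: "(\<Sum>R\<in>S'. ?a R * ?c R / ?r R) + ?a P' * ?c P' / ?r P' \<le> 2 * ?I P'"
      using ch P' less.prems(4,5) by (intro less.hyps) (auto simp: S'_def)
    have a: "?a P = ?a (P - P') + ?a P'" and c: "?c P = ?c (P - P') + ?c P'"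
      using set_nn_integral_split[of f M P P'] set_nn_integral_split[of g M P P'] Pm sub by auto
    \<comment> \<open>Telescoping of the product: peel the shell first off f and then off g.
      Enlarging the mass of f over P' to that over P then turns both shell terms into averages over
      P, as \<open>shell\<close> requires.\<close>
    have "?a P * ?c P = ?a (P - P') * ?c P + ?a P' * ?c (P - P') + ?a P' * ?c P'"
      by (subst a) (simp add: c algebra_simps)
    also have "\<dots> \<le> ?a (P - P') * ?c P + ?a P * ?c (P - P') + ?a P' * ?c P'"
      by (intro add_mono mult_right_mono) (auto simp: a)
    finally have "?a P * ?c P / ?r P \<le> (?a (P - P') * ?c P + ?a P * ?c (P - P') + ?a P' * ?c P') / ?r P"
      by (rule divide_right_mono_ennreal)
    then have "2 * (?a P * ?c P / ?r P) \<le> 2 * ((?a (P - P') * ?c P + ?a P * ?c (P - P') + ?a P' * ?c P') / ?r P)"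
      by (rule mult_left_mono) simp
    also have "\<dots> = 2 * (?a (P - P') * ?c P / ?r P + ?a P * ?c (P - P') / ?r P) + 2 * (?a P' * ?c P' / ?r P)"
      by (simp only: add_divide_distrib_ennreal distrib_left)
    also have "\<dots> \<le> 2 * ?I (P - P') + ?a P' * ?c P' / ?r P'"
      using shell[of "P - P'"] Pm pos[OF P'S] doubling[OF P'S less.prems(2) sub]
      by (intro add_mono mult_left_mono ennreal_double_divide) auto
    finally have "(\<Sum>R\<in>S'. ?a R * ?c R / ?r R) + 2 * (?a P * ?c P / ?r P)
        \<le> (\<Sum>R\<in>S'. ?a R * ?c R / ?r R) + (2 * ?I (P - P') + ?a P' * ?c P' / ?r P')"
      by (rule add_left_mono)
    also have "\<dots> = 2 * ?I (P - P') + ((\<Sum>R\<in>S'. ?a R * ?c R / ?r R) + ?a P' * ?c P' / ?r P')"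
      by (simp add: ac_simps)
    also have "\<dots> \<le> 2 * ?I (P - P') + 2 * ?I P'"
      using IH by (rule add_left_mono)
    also have "\<dots> = 2 * ?I P"
      using set_nn_integral_split[of "\<lambda>x. f x * Mg x + g x * Mf x" M P P'] Pm sub by (simp add: distrib_left)
    finally show ?thesis unfolding sum .
  qed
qed

section \<open>Cubes of a dyadic grid\<close>

text \<open>Since any part of the boundary may be included, a cube is only squeezed between an open
  and a closed box; its volume and its interior are controlled through these.\<close>

lemma cube_of_side_bounds:
  fixes Q :: "(real^'n) set"
  assumes "cube_of_side l Q"
  obtains a where "box a (\<chi> i. a $ i + l) \<subseteq> Q" "Q \<subseteq> cbox a (\<chi> i. a $ i + l)"
proof -
  obtain a I where I: "\<And>i. {a $ i <..< a $ i + l} \<subseteq> I i" "\<And>i. I i \<subseteq> {a $ i .. a $ i + l}"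
    and Q: "Q = {x. \<forall>i. x $ i \<in> I i}"
    using assms unfolding cube_of_side_def by blast
  show ?thesis
  proof (rule that)
    show "box a (\<chi> i. a $ i + l) \<subseteq> Q"
      unfolding Q using I(1) by (fastforce simp: mem_box_cart)
    show "Q \<subseteq> cbox a (\<chi> i. a $ i + l)"
      unfolding Q using I(2) by (fastforce simp: mem_box_cart)
  qed
qed

text \<open>Each factor \<open>I i\<close> differs from an open interval by at most its two
  endpoints, hence is Borel.\<close>

lemma cube_of_side_sets:
  fixes Q :: "(real^'n) set"
  assumes "cube_of_side l Q"
  shows "Q \<in> sets borel"
proof -
  obtain a I where I: "\<And>i. {a $ i <..< a $ i + l} \<subseteq> I i" "\<And>i. I i \<subseteq> {a $ i .. a $ i + l}"
    and Q: "Q = {x. \<forall>i. x $ i \<in> I i}"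
    using assms unfolding cube_of_side_def by blast
  have "I i \<in> sets borel" for i
  proof -
    have eq: "I i = {a $ i <..< a $ i + l} \<union> (I i \<inter> {a $ i, a $ i + l})"
    proof (intro equalityI subsetI)
      fix x assume x: "x \<in> I i"
      then have "a $ i \<le> x" "x \<le> a $ i + l" using I(2)[of i] by auto
      then show "x \<in> {a $ i <..< a $ i + l} \<union> (I i \<inter> {a $ i, a $ i + l})"
        using x by (cases "x = a $ i"; cases "x = a $ i + l") auto
    next
      fix x assume "x \<in> {a $ i <..< a $ i + l} \<union> (I i \<inter> {a $ i, a $ i + l})"
      then show "x \<in> I i" using I(1)[of i] by blast
    qed
    have "I i \<inter> {a $ i, a $ i + l} \<in> sets borel"
      by (rule borel_closed[OF finite_imp_closed]) simp
    then show ?thesis by (subst eq) auto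
  qed
  then have [measurable]: "\<And>i. I i \<in> sets borel" .
  have [measurable]: "(\<lambda>x::real^'n. x $ i) \<in> borel_measurable borel" for i
    by (intro borel_measurable_continuous_onI continuous_intros)
  show ?thesis unfolding Q by measurable
qed

lemma cube_of_side_emeasure:
  fixes Q :: "(real^'n) set"
  assumes "cube_of_side l Q"
  shows "emeasure lebesgue Q = ennreal (l ^ CARD('n))"
proof -
  obtain a where a: "box a (\<chi> i. a $ i + l) \<subseteq> Q" "Q \<subseteq> cbox a (\<chi> i. a $ i + l)"
    using cube_of_side_bounds[OF assms] .
  have l: "l > 0" using assms by (simp add: cube_of_side_def)
  have ne: "a \<in> cbox a (\<chi> i. a $ i + l)" using l by (simp add: mem_box_cart)
  then have m: "measure lebesgue (cbox a (\<chi> i. a $ i + l)) = l ^ CARD('n)"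
    using content_cbox_cart[of a "\<chi> i. a $ i + l"] by auto
  have c: "emeasure lebesgue (cbox a (\<chi> i. a $ i + l)) = ennreal (l ^ CARD('n))"
    by (simp only: emeasure_eq_measure2[OF lmeasurable_cbox] m)
  have o: "emeasure lebesgue (box a (\<chi> i. a $ i + l)) = ennreal (l ^ CARD('n))"
    using c by (simp add: emeasure_lborel_box_eq emeasure_lborel_cbox_eq)
  have "Q \<in> sets lebesgue" using cube_of_side_sets[OF assms] by auto
  then have "emeasure lebesgue (box a (\<chi> i. a $ i + l)) \<le> emeasure lebesgue Q"
    "emeasure lebesgue Q \<le> emeasure lebesgue (cbox a (\<chi> i. a $ i + l))"
    using a by (auto intro!: emeasure_mono simp del: emeasure_completion)
  then show ?thesis unfolding c o by (rule antisym[rotated])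
qed

lemma cube_of_side_interior:
  fixes Q :: "(real^'n) set"
  assumes "cube_of_side l Q"
  shows "interior Q \<noteq> {}"
proof -
  obtain a where a: "box a (\<chi> i. a $ i + l) \<subseteq> Q"
    using cube_of_side_bounds[OF assms] .
  have "(\<chi> i. a $ i + l / 2) \<in> box a (\<chi> i. a $ i + l)"
    using assms by (simp add: mem_box_cart cube_of_side_def)
  then show ?thesis using interior_maximal[OF a open_box] by blast
qed

text \<open>The volume determines the side, which makes the definite description in
  \<open>side_length\<close> meaningful.\<close>

lemma side_length_cube:
  fixes Q :: "(real^'n) set"
  assumes "cube_of_side l Q"
  shows "side_length Q = l"
  unfolding side_length_def
proof (rule the_equality[where P = "\<lambda>l. cube_of_side l Q", OF assms])
  fix l' assume l': "cube_of_side l' Q"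
  have "l > 0" "l' > 0" using assms l' by (auto simp: cube_of_side_def)
  moreover from this have "l' ^ CARD('n) = l ^ CARD('n)"
    using cube_of_side_emeasure[OF assms] cube_of_side_emeasure[OF l'] by simp
  ultimately show "l' = l"
    using power_eq_imp_eq_base[of l' "CARD('n)" l] by simp
qed

locale grid =
  fixes D :: "(real^'n) set set"
  assumes grid: "dyadic_grid D"
begin

lemma side_length_powi:
  assumes "Q \<in> D"
  obtains k :: int where "side_length Q = 2 powi k"
  using grid assms side_length_cube unfolding dyadic_grid_def by metis

lemma cube: "Q \<in> D \<Longrightarrow> cube_of_side (side_length Q) Q"
  using grid side_length_cube unfolding dyadic_grid_def by metis

lemma emeasure_cube: "Q \<in> D \<Longrightarrow> emeasure lebesgue Q = ennreal (side_length Q ^ CARD('n))"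
  using cube cube_of_side_emeasure by blast

lemma side_length_pos: "Q \<in> D \<Longrightarrow> 0 < side_length Q"
  using cube unfolding cube_of_side_def by blast

lemma sets_cube: "Q \<in> D \<Longrightarrow> Q \<in> sets lebesgue"
  using cube_of_side_sets[OF cube] by auto

lemma emeasure_cube_pos: "Q \<in> D \<Longrightarrow> 0 < emeasure lebesgue Q"
  by (simp add: emeasure_cube side_length_pos)

lemma emeasure_cube_finite: "Q \<in> D \<Longrightarrow> emeasure lebesgue Q < top"
  by (simp add: emeasure_cube)

lemma same_side:
  assumes "Q \<in> D" "R \<in> D" "side_length Q = side_length R" "x \<in> Q" "x \<in> R"
  shows "Q = R"
proof -
  obtain k :: int where k: "side_length Q = 2 powi k" using side_length_powi[OF assms(1)] .
  \<comment> \<open>The grid axiom indexes generations by 2^(-k), hence the double sign.\<close>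
  have "partition_on UNIV {Q\<in>D. side_length Q = 2 powi (- (- k))}"
    using grid unfolding dyadic_grid_def by blast
  then have "disjoint {Q\<in>D. side_length Q = 2 powi k}"
    by (simp add: partition_on_def)
  then show ?thesis using assms k unfolding disjoint_def by force
qed

lemma laminar_grid: "laminar D"
  using grid cube_of_side_interior[OF cube] interior_empty unfolding laminar_def dyadic_grid_def by metis

text \<open>Two intersecting cubes of equal side coincide, so a strictly smaller cube has at most
  half the side; the volume then drops by 2^n, which is at least 2.\<close>

lemma strict_subset_emeasure:
  assumes "Q \<in> D" "R \<in> D" "R \<subset> Q"
  shows "2 * emeasure lebesgue R \<le> emeasure lebesgue Q"
proof -
  obtain j k :: int where jk: "side_length R = 2 powi j" "side_length Q = 2 powi k"
    using side_length_powi assms by metis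
  have "emeasure lebesgue R \<le> emeasure lebesgue Q"
    using assms by (intro emeasure_mono sets_cube) auto
  then have "side_length R ^ CARD('n) \<le> side_length Q ^ CARD('n)"
    using side_length_pos assms by (simp add: emeasure_cube less_imp_le)
  then have "side_length R \<le> side_length Q"
    using power_mono_iff[of "side_length R" "side_length Q" "CARD('n)"]
      side_length_pos[OF assms(1)] side_length_pos[OF assms(2)] by simp
  moreover have "side_length R \<noteq> side_length Q"
  proof -
    have "R \<noteq> {}" using laminar_grid assms(2) by (auto simp: laminar_def)
    then obtain x where "x \<in> R" by auto
    then show ?thesis using same_side[OF assms(2,1), of x] assms(3) by auto
  qed
  ultimately have "j < k"
    using power_int_increasing[of k j "2::real"] unfolding jk by force
  then have "2 * (2::real) powi j \<le> 2 powi k"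
    using power_int_increasing[of "j + 1" k "2::real"] by (simp add: power_int_add)
  then have le: "(2 * side_length R) ^ CARD('n) \<le> side_length Q ^ CARD('n)"
    using side_length_pos assms jk by (intro power_mono) auto
  have "(2::real) ^ 1 \<le> 2 ^ CARD('n)"
    by (intro power_increasing) (auto simp: Suc_leI)
  then have "2 * side_length R ^ CARD('n) \<le> 2 ^ CARD('n) * side_length R ^ CARD('n)"
    using side_length_pos[OF assms(2)] by (intro mult_right_mono) auto
  also have "\<dots> \<le> side_length Q ^ CARD('n)"
    using le by (simp add: power_mult_distrib)
  finally have "ennreal (2 * side_length R ^ CARD('n)) \<le> ennreal (side_length Q ^ CARD('n))"
    by (rule ennreal_leI)
  then show ?thesis
    unfolding emeasure_cube[OF assms(1)] emeasure_cube[OF assms(2)] by (simp add: ennreal_mult')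
qed

lemma geometric_chain_grid:
  "finite S \<Longrightarrow> S \<subseteq> D \<Longrightarrow> nested S \<Longrightarrow> geometric_chain lebesgue S"
  by unfold_locales (auto intro: sets_cube emeasure_cube_pos strict_subset_emeasure)

text \<open>There is one generation for each integer, and each generation is a disjoint family of
  sets with nonempty interior.\<close>

lemma countable_grid: "countable D"
proof -
  define E where "E k = {Q\<in>D. side_length Q = 2 powi k}" for k :: int
  have "countable (E k)" for k
  proof (rule countable_disjoint_nonempty_interior_subsets)
    show "disjoint (E k)"
      unfolding disjoint_def
    proof (intro ballI impI)
      fix Q R assume "Q \<in> E k" "R \<in> E k" "Q \<noteq> R"
      then show "Q \<inter> R = {}"
        using same_side[of Q R] unfolding E_def by auto
    qed
    show "S = {}" if "S \<in> E k" "interior S = {}" for S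
      using that cube_of_side_interior[OF cube] unfolding E_def by blast
  qed
  moreover have "D = (\<Union>k. E k)" unfolding E_def using side_length_powi by blast
  ultimately show ?thesis by (metis countable_UN countableI_type)
qed

end

section \<open>Weighted Hoelder inequalities\<close>

lemma conj_exp_gt_1: "1 < r \<Longrightarrow> 1 < conj_exp r"
  by (simp add: conj_exp_def)

lemma inverse_conj_exp: "1 < r \<Longrightarrow> 1 / conj_exp r = 1 - 1 / r"
  by (simp add: conj_exp_def field_simps)

lemma ennpowr_cancel:
  assumes "0 < w" "w < top" "a + b = 0"
  shows "ennpowr w a * ennpowr w b = 1"
proof -
  obtain r where r: "w = ennreal r" "0 < r"
    using assms by (cases w) auto
  have *: "ennpowr w c = ennreal (r powr c)" for c
    using r by (auto simp: ennpowr_def)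
  have "r powr a * r powr b = 1"
    using r assms(3) by (simp flip: powr_add)
  then show ?thesis unfolding * by (simp flip: ennreal_mult)
qed

lemma ennpowr_less_top: "0 < a \<Longrightarrow> x < top \<Longrightarrow> ennpowr x a < top"
  by (cases x) (auto simp: ennpowr_ennreal)

lemma ennpowr_add:
  assumes "0 < w" "w < top"
  shows "ennpowr w (a + b) = ennpowr w a * ennpowr w b"
proof -
  obtain r where r: "w = ennreal r" "0 < r"
    using assms by (cases w) auto
  then have "ennpowr w c = ennreal (r powr c)" for c
    by (auto simp: ennpowr_def)
  then show ?thesis by (simp add: powr_add ennreal_mult)
qed

lemma ennpowr_ennpowr_pos:
  assumes "0 < w" "w < top"
  shows "ennpowr (ennpowr w a) b = ennpowr w (a * b)"
proof -
  obtain r where r: "w = ennreal r" "0 < r"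
    using assms by (cases w) auto
  then show ?thesis
    by (auto simp: ennpowr_def powr_powr)
qed

text \<open>Where w is infinite, the dual weight is 0 and would lose G; there the finiteness of the
  integral of F^r w forces F = 0 a.e. Elsewhere the powers of w cancel, because (1 - r')(1 - 1/r) =
  -1/r.\<close>

lemma weighted_Holder:
  fixes F G w :: "real^'n \<Rightarrow> ennreal"
  assumes r: "1 < r"
    and [measurable]: "F \<in> borel_measurable lebesgue" "G \<in> borel_measurable lebesgue" "w \<in> borel_measurable lebesgue"
    and w: "AE x in lebesgue. 0 < w x"
    and fin: "(\<integral>\<^sup>+x. ennpowr (F x) r * w x \<partial>lebesgue) < top"
  shows "(\<integral>\<^sup>+x. F x * G x \<partial>lebesgue)
    \<le> Lnorm r w F * Lnorm (conj_exp r) (\<lambda>x. ennpowr (w x) (1 - conj_exp r)) G"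
proof -
  let ?s = "conj_exp r"
  have s: "1 < ?s" "1 / ?s = 1 - 1 / r" using r conj_exp_gt_1 inverse_conj_exp by auto
  have "AE x in lebesgue. ennpowr (F x) r * w x \<noteq> \<infinity>"
    using fin by (intro nn_integral_PInf_AE) auto
  with w have "AE x in lebesgue. F x * G x
      \<le> ennpowr (ennpowr (F x) r * w x) (1 / r) * ennpowr (ennpowr (G x) ?s * ennpowr (w x) (1 - ?s)) (1 - 1 / r)"
  proof eventually_elim
    case (elim x)
    show ?case
    proof (cases "w x = top")
      case True
      with elim have "ennpowr (F x) r = 0" by (auto simp: ennreal_mult_top split: if_splits)
      then have "F x = 0" using r by (simp add: ennpowr_eq_0_iff)
      then show ?thesis by simp
    next
      case False
      then have w: "0 < w x" "w x < top" using elim by (auto simp: less_top)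
      have 1: "ennpowr (ennpowr (F x) r * w x) (1 / r) = F x * ennpowr (w x) (1 / r)"
        using r by (simp add: ennpowr_mult ennpowr_ennpowr ennpowr_one)
      have "?s * (1 - 1 / r) = 1" using s by (simp add: field_simps)
      moreover have "(1 - ?s) * (1 - 1 / r) = - (1 / r)" using r by (simp add: conj_exp_def field_simps)
      ultimately have 2: "ennpowr (ennpowr (G x) ?s * ennpowr (w x) (1 - ?s)) (1 - 1 / r) = G x * ennpowr (w x) (- (1 / r))"
        using r s w by (simp add: ennpowr_mult ennpowr_ennpowr ennpowr_ennpowr_pos ennpowr_one)
      have "F x * G x = F x * G x * (ennpowr (w x) (1 / r) * ennpowr (w x) (- (1 / r)))"
        using w by (subst ennpowr_cancel) auto
      then show ?thesis unfolding 1 2 by (simp add: mult_ac)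
    qed
  qed
  then have "(\<integral>\<^sup>+x. F x * G x \<partial>lebesgue) \<le>
      ennpowr (\<integral>\<^sup>+x. ennpowr (F x) r * w x \<partial>lebesgue) (1 / r) *
      ennpowr (\<integral>\<^sup>+x. ennpowr (G x) ?s * ennpowr (w x) (1 - ?s) \<partial>lebesgue) (1 - 1 / r)"
    using r by (intro nn_integral_Holder) auto
  then show ?thesis unfolding Lnorm_def s(2) .
qed

text \<open>Split u as u^(1/r) u^(1 - 1/r) where 0 < u < \<infinity>. Integrating against u itself
  keeps the dual factor in the form of the mass \<open>gam\<close>, with no negative power of
  u.\<close>

lemma Holder_wrt_weight:
  fixes g G u :: "real^'n \<Rightarrow> ennreal"
  assumes r: "1 < r"
    and [measurable]: "g \<in> borel_measurable lebesgue" "G \<in> borel_measurable lebesgue" "u \<in> borel_measurable lebesgue"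
    and u: "AE x in lebesgue. u x < \<infinity>"
  shows "(\<integral>\<^sup>+x. g x * u x * G x \<partial>lebesgue)
    \<le> ennpowr (\<integral>\<^sup>+x. ennpowr (g x) (conj_exp r) * u x \<partial>lebesgue) (1 / conj_exp r) * Lnorm r u G"
proof -
  let ?s = "conj_exp r"
  have s: "1 < ?s" "1 / ?s = 1 - 1 / r" using r conj_exp_gt_1 inverse_conj_exp by auto
  have "AE x in lebesgue. g x * u x * G x
      \<le> ennpowr (ennpowr (G x) r * u x) (1 / r) * ennpowr (ennpowr (g x) ?s * u x) (1 - 1 / r)"
    using u
  proof eventually_elim
    case (elim x)
    show ?case
    proof (cases "u x = 0")
      case False
      then have u: "0 < u x" "u x < top" using elim by (auto simp: zero_less_iff_neq_zero)
      have 1: "ennpowr (ennpowr (G x) r * u x) (1 / r) = G x * ennpowr (u x) (1 / r)"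
        using r by (simp add: ennpowr_mult ennpowr_ennpowr ennpowr_one)
      have "?s * (1 - 1 / r) = 1" using s by (simp add: field_simps)
      then have 2: "ennpowr (ennpowr (g x) ?s * u x) (1 - 1 / r) = g x * ennpowr (u x) (1 - 1 / r)"
        using r s by (simp add: ennpowr_mult ennpowr_ennpowr ennpowr_one)
      have "u x = ennpowr (u x) (1 / r) * ennpowr (u x) (1 - 1 / r)"
        using ennpowr_add[OF u, of "1 / r" "1 - 1 / r"] by (simp add: ennpowr_one)
      then have "g x * u x * G x = g x * (ennpowr (u x) (1 / r) * ennpowr (u x) (1 - 1 / r)) * G x"
        by simp
      then show ?thesis unfolding 1 2 by (simp add: mult_ac)
    qed simp
  qed
  then have "(\<integral>\<^sup>+x. g x * u x * G x \<partial>lebesgue) \<le>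
      ennpowr (\<integral>\<^sup>+x. ennpowr (G x) r * u x \<partial>lebesgue) (1 / r) *
      ennpowr (\<integral>\<^sup>+x. ennpowr (g x) ?s * u x \<partial>lebesgue) (1 - 1 / r)"
    using r by (intro nn_integral_Holder) auto
  then show ?thesis unfolding Lnorm_def s(2) by (simp add: mult.commute)
qed

lemma sum_set_nn_integral_le:
  assumes [measurable]: "f \<in> borel_measurable M" and L: "finite L" "\<And>R. R \<in> L \<Longrightarrow> R \<in> sets M"
    and "disjoint L" "\<Union>L \<subseteq> X"
  shows "(\<Sum>R\<in>L. \<integral>\<^sup>+x\<in>R. f x \<partial>M) \<le> (\<integral>\<^sup>+x\<in>X. f x \<partial>M)"
proof -
  have "(\<Sum>R\<in>L. \<integral>\<^sup>+x\<in>R. f x \<partial>M) = (\<integral>\<^sup>+x. (\<Sum>R\<in>L. f x * indicator R x) \<partial>M)"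
    using L by (intro nn_integral_sum[symmetric]) auto
  also have "\<dots> \<le> (\<integral>\<^sup>+x\<in>X. f x \<partial>M)"
  proof (rule nn_integral_mono)
    fix x
    show "(\<Sum>R\<in>L. f x * indicator R x) \<le> f x * indicator X x"
    proof (cases "\<exists>R\<in>L. x \<in> R")
      case True
      then obtain R where R: "R \<in> L" "x \<in> R" by auto
      have "(\<Sum>R\<in>L. f x * indicator R x) = (\<Sum>R\<in>{R}. f x * indicator R x)"
        using R L(1) assms(4) by (intro sum.mono_neutral_right) (auto simp: disjoint_def indicator_def)
      then show ?thesis using R assms(5) by (auto split: split_indicator)
    next
      case False
      then have "(\<Sum>R\<in>L. f x * indicator R x) = 0"
        by (intro sum.neutral) (auto split: split_indicator)
      then show ?thesis by simp
    qed
  qed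
  finally show ?thesis .
qed

lemma nn_integral_count_space_le:
  fixes b :: "'a \<Rightarrow> ennreal"
  assumes "countable D" and le: "\<And>S. finite S \<Longrightarrow> S \<subseteq> D \<Longrightarrow> sum b S \<le> c"
  shows "(\<integral>\<^sup>+Q. b Q \<partial>count_space D) \<le> c"
proof (cases "finite D")
  case True
  then show ?thesis using le[of D] by (simp add: nn_integral_count_space_finite)
next
  case False
  have bij: "bij_betw (from_nat_into D) UNIV D"
    using assms(1) False by (rule bij_betw_from_nat_into)
  have "(\<integral>\<^sup>+Q. b Q \<partial>count_space D) = (\<Sum>i. b (from_nat_into D i))"
    using nn_integral_bij_count_space[OF bij, of b] by (simp add: nn_integral_count_space_nat)
  also have "\<dots> \<le> c"
    unfolding suminf_eq_SUP
  proof (rule SUP_least)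
    fix n
    have "(\<Sum>i<n. b (from_nat_into D i)) = sum b (from_nat_into D ` {..<n})"
      using bij by (subst sum.reindex) (auto simp: bij_betw_def intro: inj_on_subset)
    also have "\<dots> \<le> c"
      using bij by (intro le) (auto simp: bij_betw_def)
    finally show "(\<Sum>i<n. b (from_nat_into D i)) \<le> c" .
  qed
  finally show ?thesis .
qed

section \<open>The bilinear estimate\<close>

context grid
begin

text \<open>With the point moved into the indicator, the index set no longer depends on x;
  measurability then follows from a countable supremum.\<close>

lemma dyadic_maximal_eq_SUP:
  "dyadic_maximal D f x =
     (SUP Q\<in>D. (\<integral>\<^sup>+y\<in>Q. absfun f y \<partial>lebesgue) / emeasure lebesgue Q * indicator Q x)"
  unfolding dyadic_maximal_def absfun_def
proof (intro antisym SUP_least)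
  fix Q assume "Q \<in> {Q \<in> D. x \<in> Q}"
  then show "(\<integral>\<^sup>+y\<in>Q. ennreal (norm (f y)) \<partial>lebesgue) / emeasure lebesgue Q
      \<le> (SUP Q\<in>D. (\<integral>\<^sup>+y\<in>Q. ennreal (norm (f y)) \<partial>lebesgue) / emeasure lebesgue Q * indicator Q x)"
    by (intro SUP_upper2[of Q]) auto
next
  fix Q assume "Q \<in> D"
  then show "(\<integral>\<^sup>+y\<in>Q. ennreal (norm (f y)) \<partial>lebesgue) / emeasure lebesgue Q * indicator Q x
      \<le> (SUP Q\<in>{Q \<in> D. x \<in> Q}. (\<integral>\<^sup>+y\<in>Q. ennreal (norm (f y)) \<partial>lebesgue) / emeasure lebesgue Q)"
    by (cases "x \<in> Q") (auto intro: SUP_upper)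
qed

lemma measurable_dyadic_maximal [measurable]: "dyadic_maximal D f \<in> borel_measurable lebesgue"
  unfolding dyadic_maximal_eq_SUP[abs_def]
  using countable_grid sets_cube by (intro borel_measurable_SUP) auto

lemma dyadic_maximal_upper:
  "R \<in> D \<Longrightarrow> x \<in> R \<Longrightarrow> (\<integral>\<^sup>+y\<in>R. absfun f y \<partial>lebesgue) / emeasure lebesgue R \<le> dyadic_maximal D f x"
  unfolding dyadic_maximal_def absfun_def by (rule SUP_upper) auto

text \<open>The operator T of the overview. An integral against counting measure sums over the whole
  infinite grid in \<open>ennreal\<close> and makes Tonelli available.\<close>

definition pos_op :: "((real^'n) \<Rightarrow> complex) \<Rightarrow> (real^'n) \<Rightarrow> ennreal" where
  "pos_op f x =
     (\<integral>\<^sup>+Q. (\<integral>\<^sup>+y\<in>Q. absfun f y \<partial>lebesgue) / emeasure lebesgue Q * indicator Q x \<partial>count_space D)"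

lemma measurable_pos_op [measurable]: "pos_op f \<in> borel_measurable lebesgue"
proof (cases "finite D")
  case True
  then show ?thesis
    unfolding pos_op_def[abs_def] nn_integral_count_space_finite[OF True]
    using sets_cube by (intro borel_measurable_sum borel_measurable_times_ennreal borel_measurable_indicator) auto
next
  case False
  then have "bij_betw (from_nat_into D) UNIV D"
    by (rule bij_betw_from_nat_into[OF countable_grid])
  moreover from this have "from_nat_into D i \<in> sets lebesgue" for i
    using sets_cube by (auto simp: bij_betw_def)
  ultimately show ?thesis
    unfolding pos_op_def[abs_def]
    by (simp add: nn_integral_bij_count_space[symmetric] nn_integral_count_space_nat)
qed

end

section \<open>Masses, dual functions and pairings for a pair of weights\<close>

locale two_weight = grid D for D :: "(real^'n) set set" +
  fixes p q :: real and u v :: "(real^'n) \<Rightarrow> ennreal"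
  assumes p: "1 < p" and pq: "p < q" and weights: "weight_pair u v"
begin

lemma q: "1 < q" using p pq by simp

lemma measurable_weights [measurable]: "u \<in> borel_measurable lebesgue" "v \<in> borel_measurable lebesgue"
  using weights by (auto simp: weight_pair_def)

lemma u_finite: "AE x in lebesgue. u x < \<infinity>" and v_pos: "AE x in lebesgue. 0 < v x"
  using weights by (auto simp: weight_pair_def)

abbreviation "q' \<equiv> conj_exp q"
abbreviation "p' \<equiv> conj_exp p"

lemma q': "1 < q'" "1 / q' = 1 - 1 / q"
  using q conj_exp_gt_1 inverse_conj_exp by auto

definition nu :: "((real^'n) \<Rightarrow> complex) \<Rightarrow> (real^'n) set \<Rightarrow> ennreal" where
  "nu f X = (\<integral>\<^sup>+x\<in>X. ennpowr (absfun f x) p * v x \<partial>lebesgue)"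

definition gam :: "((real^'n) \<Rightarrow> ennreal) \<Rightarrow> (real^'n) set \<Rightarrow> ennreal" where
  "gam g X = (\<integral>\<^sup>+x\<in>X. ennpowr (g x) q' * u x \<partial>lebesgue)"

text \<open>Yields the assumption \<open>null\<close> of the recursion: a cube of zero mass
  contributes nothing to the bilinear form.\<close>

lemma gam_0D:
  assumes [measurable]: "g \<in> borel_measurable lebesgue" "X \<in> sets lebesgue" and "gam g X = 0"
  shows "(\<integral>\<^sup>+x\<in>X. g x * u x \<partial>lebesgue) = 0"
proof -
  have "AE x in lebesgue. ennpowr (g x) q' * u x * indicator X x = 0"
    using assms(3) unfolding gam_def by (subst (asm) nn_integral_0_iff_AE) auto
  then have "AE x in lebesgue. g x * u x * indicator X x = 0"
    by eventually_elim (use q' in \<open>auto simp: ennpowr_eq_0_iff\<close>)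
  then show ?thesis by (subst nn_integral_0_iff_AE) auto
qed

text \<open>The product g u as a complex function, the type on which \<open>dyadic_maximal\<close>
  acts. Converting \<infinity> to 0 changes it only on a null set, since g is finite in all
  applications and u is finite a.e.\<close>

definition dual_fun :: "((real^'n) \<Rightarrow> ennreal) \<Rightarrow> (real^'n) \<Rightarrow> complex" where
  "dual_fun g x = complex_of_real (enn2real (g x * u x))"

lemma measurable_dual_fun:
  assumes [measurable]: "g \<in> borel_measurable lebesgue"
  shows "dual_fun g \<in> borel_measurable lebesgue"
  unfolding dual_fun_def[abs_def] by measurable

lemma measurable_absfun:
  assumes [measurable]: "f \<in> borel_measurable lebesgue"
  shows "absfun f \<in> borel_measurable lebesgue"
  unfolding absfun_def[abs_def] by measurable

lemma absfun_dual_fun: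
  assumes "\<And>x. g x < \<infinity>"
  shows "AE x in lebesgue. absfun (dual_fun g) x = g x * u x"
  using u_finite
proof eventually_elim
  case (elim x)
  then have "g x * u x < top" using assms[of x] by (simp add: ennreal_mult_less_top)
  then show ?case by (simp add: absfun_def dual_fun_def enn2real_nonneg)
qed

lemma set_nn_integral_dual_fun:
  assumes "\<And>x. g x < \<infinity>"
  shows "(\<integral>\<^sup>+x\<in>R. absfun (dual_fun g) x \<partial>lebesgue) = (\<integral>\<^sup>+x\<in>R. g x * u x \<partial>lebesgue)"
  using absfun_dual_fun[of g, OF assms] by (intro nn_integral_cong_AE) auto

text \<open>Pointwise (g u)^q' u^(1 - q') = g^q' u. Where u = 0 the dual weight is \<infinity>, and
  the identity rests on \<open>0 * \<infinity> = 0\<close>.\<close>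

lemma Lnorm_dual_fun:
  assumes "\<And>x. g x < \<infinity>"
  shows "Lnorm q' (\<lambda>x. ennpowr (u x) (1 - q')) (absfun (dual_fun g)) = ennpowr (gam g UNIV) (1 / q')"
proof -
  have "AE x in lebesgue. ennpowr (absfun (dual_fun g) x) q' * ennpowr (u x) (1 - q') = ennpowr (g x) q' * u x"
    using absfun_dual_fun[of g, OF assms] u_finite
  proof eventually_elim
    case (elim x)
    show ?case
    proof (cases "u x = 0")
      case False
      then have u: "0 < u x" "u x < top" using elim by (auto simp: zero_less_iff_neq_zero)
      have "u x = ennpowr (u x) q' * ennpowr (u x) (1 - q')"
        using ennpowr_add[OF u, of q' "1 - q'"] by (simp add: ennpowr_one)
      then show ?thesis using q' by (simp add: elim ennpowr_mult mult_ac)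
    qed (use q' elim in \<open>simp add: ennpowr_zero\<close>)
  qed
  then show ?thesis
    unfolding Lnorm_def gam_def by (auto intro!: arg_cong[where f = "\<lambda>t. ennpowr t (1 / q')"] nn_integral_cong_AE)
qed

text \<open>Finite values make \<open>dual_fun\<close> faithful to g u a.e.; finite mass puts it
  into the dual space and later allows division by a power of the mass.\<close>

definition test_fun :: "((real^'n) \<Rightarrow> ennreal) \<Rightarrow> bool" where
  "test_fun g \<longleftrightarrow> g \<in> borel_measurable lebesgue \<and> (\<forall>x. g x < \<infinity>) \<and> gam g UNIV < \<infinity>"

lemma gam_mono: "X \<subseteq> Y \<Longrightarrow> gam g X \<le> gam g Y"
  unfolding gam_def by (intro nn_integral_mono) (auto split: split_indicator)

lemma nu_mono: "X \<subseteq> Y \<Longrightarrow> nu f X \<le> nu f Y"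
  unfolding nu_def by (intro nn_integral_mono) (auto split: split_indicator)

lemma gam_finite: "test_fun g \<Longrightarrow> gam g X < \<infinity>"
  using gam_mono[of X UNIV g] unfolding test_fun_def by (meson le_less_trans subset_UNIV)

lemma Lnorm_nu: "Lnorm p v (absfun f) = ennpowr (nu f UNIV) (1 / p)"
  by (simp add: Lnorm_def nu_def)

lemma nu_finite: "f \<in> Lspace p v \<Longrightarrow> nu f X < \<infinity>"
  using nu_mono[of X UNIV f] p ennpowr_eq_top_iff[of "1 / p" "nu f UNIV"]
  by (auto simp: Lspace_def Lnorm_nu less_top top_unique)

text \<open>Localisation to P: averages over cubes inside P are unchanged, while the global norm
  shrinks to the mass of P.\<close>

definition restr :: "(real^'n) set \<Rightarrow> ((real^'n) \<Rightarrow> complex) \<Rightarrow> (real^'n) \<Rightarrow> complex" where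
  "restr P f x = (if x \<in> P then f x else 0)"

lemma absfun_restr: "absfun (restr P f) x = absfun f x * indicator P x"
  by (simp add: absfun_def restr_def)

lemma nu_restr: "nu (restr P f) UNIV = nu f P"
  unfolding nu_def using p
  by (intro nn_integral_cong) (auto simp: absfun_restr ennpowr_zero split: split_indicator)

lemma gam_restr: "gam (\<lambda>x. g x * indicator P x) UNIV = gam g P"
  unfolding gam_def using q'
  by (intro nn_integral_cong) (auto simp: ennpowr_zero split: split_indicator)

lemma restr_Lspace:
  assumes "f \<in> Lspace p v" "P \<in> sets lebesgue"
  shows "restr P f \<in> Lspace p v"
proof -
  have [measurable]: "f \<in> borel_measurable lebesgue" "P \<in> sets lebesgue" using assms by (auto simp: Lspace_def)
  have "restr P f \<in> borel_measurable lebesgue" unfolding restr_def[abs_def] by measurable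
  moreover have "Lnorm p v (absfun (restr P f)) < \<infinity>"
    unfolding Lnorm_nu nu_restr using nu_finite[OF assms(1), of P] p
    by (simp add: ennpowr_less_top)
  ultimately show ?thesis by (simp add: Lspace_def)
qed

lemma test_fun_restr:
  assumes "test_fun g" "P \<in> sets lebesgue"
  shows "test_fun (\<lambda>x. g x * indicator P x)"
proof -
  have [measurable]: "g \<in> borel_measurable lebesgue" "P \<in> sets lebesgue" using assms by (auto simp: test_fun_def)
  have "g x * indicator P x < \<infinity>" for x
    using assms(1) by (auto simp: test_fun_def split: split_indicator)
  then show ?thesis
    using gam_finite[OF assms(1), of P] unfolding test_fun_def gam_restr by simp
qed

definition dual_bound :: "real \<Rightarrow> bool" where
  "dual_bound A \<longleftrightarrow> 0 \<le> A \<and> (\<forall>f\<in>Lspace q' (\<lambda>x. ennpowr (u x) (1 - q')).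
     Lnorm p' (\<lambda>x. ennpowr (v x) (1 - p')) (dyadic_maximal D f)
       \<le> ennreal A * Lnorm q' (\<lambda>x. ennpowr (u x) (1 - q')) (absfun f))"

definition primal_bound :: "real \<Rightarrow> bool" where
  "primal_bound A \<longleftrightarrow> 0 \<le> A \<and> (\<forall>f\<in>Lspace p v.
     Lnorm q u (dyadic_maximal D f) \<le> ennreal A * Lnorm p v (absfun f))"

text \<open>The constant in \<open>maximal_bounded\<close> may be negative, in which case
  \<open>ennreal\<close> reads it as 0; replacing it by its maximum with 0 is harmless and makes it
  usable in real arithmetic.\<close>

lemma maximal_bounded_nonneg:
  assumes "maximal_bounded D r w s w'"
  obtains A where "0 \<le> A" "\<forall>f\<in>Lspace r w. Lnorm s w' (dyadic_maximal D f) \<le> ennreal A * Lnorm r w (absfun f)"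
proof -
  obtain A where "\<forall>f\<in>Lspace r w. Lnorm s w' (dyadic_maximal D f) \<le> ennreal A * Lnorm r w (absfun f)"
    using assms unfolding maximal_bounded_def by blast
  moreover have "ennreal A * t \<le> ennreal (max A 0) * t" for t
    by (intro mult_right_mono ennreal_leI) auto
  ultimately have "\<forall>f\<in>Lspace r w. Lnorm s w' (dyadic_maximal D f) \<le> ennreal (max A 0) * Lnorm r w (absfun f)"
    by (blast intro: order_trans)
  then show ?thesis using that[of "max A 0"] by auto
qed

text \<open>Hoelder with respect to v, followed by the dual hypothesis for g u;
  \<open>Lnorm_dual_fun\<close> turns the norm on the right into the mass of g.\<close>

lemma dual_pairing:
  assumes A: "dual_bound A" and f: "f \<in> Lspace p v" and g: "test_fun g"
  shows "(\<integral>\<^sup>+x. absfun f x * dyadic_maximal D (dual_fun g) x \<partial>lebesgue)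
    \<le> ennreal A * ennpowr (nu f UNIV) (1 / p) * ennpowr (gam g UNIV) (1 / q')"
proof -
  have [measurable]: "f \<in> borel_measurable lebesgue" "g \<in> borel_measurable lebesgue"
    using f g by (auto simp: Lspace_def test_fun_def)
  have fin: "\<And>x. g x < \<infinity>" using g by (auto simp: test_fun_def)
  have "ennpowr (gam g UNIV) (1 / q') < \<infinity>"
    using g q'(1) by (simp add: test_fun_def ennpowr_less_top)
  then have mem: "dual_fun g \<in> Lspace q' (\<lambda>x. ennpowr (u x) (1 - q'))"
    using measurable_dual_fun by (auto simp: Lspace_def Lnorm_dual_fun[OF fin])
  have "(\<integral>\<^sup>+x. absfun f x * dyadic_maximal D (dual_fun g) x \<partial>lebesgue)
    \<le> Lnorm p v (absfun f) * Lnorm p' (\<lambda>x. ennpowr (v x) (1 - p')) (dyadic_maximal D (dual_fun g))"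
    using v_pos p nu_finite[OF f, of UNIV] measurable_absfun[OF \<open>f \<in> borel_measurable lebesgue\<close>]
    by (intro weighted_Holder) (auto simp: nu_def)
  also have "\<dots> \<le> Lnorm p v (absfun f) * (ennreal A * Lnorm q' (\<lambda>x. ennpowr (u x) (1 - q')) (absfun (dual_fun g)))"
    using A mem by (intro mult_left_mono) (auto simp: dual_bound_def)
  finally show ?thesis unfolding Lnorm_dual_fun[OF fin] Lnorm_nu by (simp add: mult_ac)
qed

text \<open>Mirror image of \<open>dual_pairing\<close>: Hoelder with respect to u, then the bound
  for the maximal function of f.\<close>

lemma primal_pairing:
  assumes A: "primal_bound A" and f: "f \<in> Lspace p v" and g: "test_fun g"
  shows "(\<integral>\<^sup>+x. g x * u x * dyadic_maximal D f x \<partial>lebesgue)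
    \<le> ennreal A * ennpowr (nu f UNIV) (1 / p) * ennpowr (gam g UNIV) (1 / q')"
proof -
  have [measurable]: "g \<in> borel_measurable lebesgue"
    using g by (auto simp: test_fun_def)
  have "(\<integral>\<^sup>+x. g x * u x * dyadic_maximal D f x \<partial>lebesgue)
    \<le> ennpowr (gam g UNIV) (1 / q') * Lnorm q u (dyadic_maximal D f)"
    using Holder_wrt_weight[OF q _ _ _ u_finite, of g "dyadic_maximal D f"] by (simp add: gam_def)
  also have "\<dots> \<le> ennpowr (gam g UNIV) (1 / q') * (ennreal A * Lnorm p v (absfun f))"
    using A f by (intro mult_left_mono) (auto simp: primal_bound_def)
  finally show ?thesis unfolding Lnorm_nu by (simp add: mult_ac)
qed

definition pair_term :: "((real^'n) \<Rightarrow> complex) \<Rightarrow> ((real^'n) \<Rightarrow> ennreal) \<Rightarrow> (real^'n) set \<Rightarrow> ennreal" where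
  "pair_term f g R = (\<integral>\<^sup>+x\<in>R. absfun f x \<partial>lebesgue) * (\<integral>\<^sup>+x\<in>R. g x * u x \<partial>lebesgue) / emeasure lebesgue R"

lemma nn_integral_pos_op:
  assumes [measurable]: "g \<in> borel_measurable lebesgue"
  shows "(\<integral>\<^sup>+x. pos_op f x * (g x * u x) \<partial>lebesgue) = (\<integral>\<^sup>+R. pair_term f g R \<partial>count_space D)"
proof -
  let ?c = "\<lambda>R. (\<integral>\<^sup>+y\<in>R. absfun f y \<partial>lebesgue) / emeasure lebesgue R"
  have "(\<integral>\<^sup>+x. pos_op f x * (g x * u x) \<partial>lebesgue)
      = (\<integral>\<^sup>+x. \<integral>\<^sup>+R. ?c R * indicator R x * (g x * u x) \<partial>count_space D \<partial>lebesgue)"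
    unfolding pos_op_def by (subst nn_integral_multc) auto
  also have "\<dots> = (\<integral>\<^sup>+R. \<integral>\<^sup>+x. ?c R * indicator R x * (g x * u x) \<partial>lebesgue \<partial>count_space D)"
  proof (rule nn_integral_count_space_nn_integral[OF countable_grid])
    fix R assume "R \<in> D"
    then have [measurable]: "R \<in> sets lebesgue" by (rule sets_cube)
    show "(\<lambda>x. ?c R * indicator R x * (g x * u x)) \<in> borel_measurable lebesgue" by measurable
  qed
  also have "\<dots> = (\<integral>\<^sup>+R. pair_term f g R \<partial>count_space D)"
  proof (rule nn_integral_cong)
    fix R assume "R \<in> space (count_space D)"
    then have [measurable]: "R \<in> sets lebesgue" using sets_cube by simp
    have "(\<integral>\<^sup>+x. ?c R * indicator R x * (g x * u x) \<partial>lebesgue) = (\<integral>\<^sup>+x. ?c R * (g x * u x * indicator R x) \<partial>lebesgue)"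
      by (simp add: mult_ac)
    also have "\<dots> = ?c R * (\<integral>\<^sup>+x\<in>R. g x * u x \<partial>lebesgue)"
      by (rule nn_integral_cmult) measurable
    finally show "(\<integral>\<^sup>+x. ?c R * indicator R x * (g x * u x) \<partial>lebesgue) = pair_term f g R"
      by (simp add: pair_term_def divide_ennreal_def mult_ac)
  qed
  finally show ?thesis .
qed

text \<open>Interface between the weak and strong type arguments and the recursion. Heaviness is
  written without division and non-strictly, which is convenient in \<open>ennreal\<close> and
  covers the strict version of the locale.\<close>

definition heavy_chain_bound :: "real \<Rightarrow> ((real^'n) \<Rightarrow> complex) \<Rightarrow> ((real^'n) \<Rightarrow> ennreal) \<Rightarrow> bool" where
  "heavy_chain_bound C f g \<longleftrightarrow>
    (\<forall>P S. P \<in> D \<longrightarrow> finite S \<longrightarrow> S \<subseteq> D \<longrightarrow> nested S \<longrightarrow> (\<forall>R\<in>S. R \<subseteq> P \<and> gam g P \<le> 2 * gam g R) \<longrightarrow>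
       sum (pair_term f g) S \<le> ennreal C * ennpowr (nu f P) (1 / p) * ennpowr (gam g P) (1 / q'))"

lemma set_nn_integral_restr:
  "R \<subseteq> P \<Longrightarrow> (\<integral>\<^sup>+x\<in>R. absfun (restr P f) x \<partial>lebesgue) = (\<integral>\<^sup>+x\<in>R. absfun f x \<partial>lebesgue)"
  by (intro nn_integral_cong) (auto simp: absfun_restr split: split_indicator)

lemma set_nn_integral_dual_fun_restr:
  assumes "test_fun g" "R \<subseteq> P"
  shows "(\<integral>\<^sup>+x\<in>R. absfun (dual_fun (\<lambda>x. g x * indicator P x)) x \<partial>lebesgue) = (\<integral>\<^sup>+x\<in>R. g x * u x \<partial>lebesgue)"
proof -
  have "g x * indicator P x < \<infinity>" for x
    using assms(1) by (auto simp: test_fun_def split: split_indicator)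
  then have "(\<integral>\<^sup>+x\<in>R. absfun (dual_fun (\<lambda>x. g x * indicator P x)) x \<partial>lebesgue)
      = (\<integral>\<^sup>+x\<in>R. g x * indicator P x * u x \<partial>lebesgue)"
    by (rule set_nn_integral_dual_fun)
  also have "\<dots> = (\<integral>\<^sup>+x\<in>R. g x * u x \<partial>lebesgue)"
    using assms(2) by (intro nn_integral_cong) (auto split: split_indicator)
  finally show ?thesis .
qed

text \<open>For an indicator g^q' = g, so the integral of g u over R is the mass of R. Heaviness
  then makes c / |R| with c = \<open>gam g P\<close> at most twice the maximal function of g u on R.
  Of the factor 4, one 2 is due to heaviness and the other to
  \<open>chain_kernel_bound\<close>.\<close>

lemma heavy_chain_bound_dual:
  assumes A: "dual_bound A" and f: "f \<in> Lspace p v" and g: "test_fun g"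
    and g01: "\<And>x. g x = 0 \<or> g x = 1"
  shows "heavy_chain_bound (4 * A) f g"
  unfolding heavy_chain_bound_def
proof (intro allI impI)
  fix P S assume S: "P \<in> D" "finite S" "S \<subseteq> D" "nested S" and heavy: "\<forall>R\<in>S. R \<subseteq> P \<and> gam g P \<le> 2 * gam g R"
  have [measurable]: "g \<in> borel_measurable lebesgue" "f \<in> borel_measurable lebesgue" "P \<in> sets lebesgue"
    using f g S(1) sets_cube by (auto simp: test_fun_def Lspace_def)
  note [measurable] = measurable_absfun
  have gam: "gam g X = (\<integral>\<^sup>+x\<in>X. g x * u x \<partial>lebesgue)" for X
  proof -
    have "ennpowr (g x) q' = g x" for x
      using g01[of x] q'(1) ennpowr_ennreal[of q' 1] by (auto simp: ennpowr_zero)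
    then show ?thesis by (simp add: gam_def)
  qed
  show "sum (pair_term f g) S \<le> ennreal (4 * A) * ennpowr (nu f P) (1 / p) * ennpowr (gam g P) (1 / q')"
  proof (cases "S = {}")
    case False
    then obtain T where T: "T \<in> S" "\<And>R. R \<in> S \<Longrightarrow> R \<subseteq> T"
      using nested_has_top S by metis
    let ?g = "\<lambda>x. g x * indicator P x"
    let ?k = "\<lambda>x. 2 * dyadic_maximal D (dual_fun ?g) x"
    have k: "gam g P / emeasure lebesgue R \<le> ?k x" if R: "R \<in> S" and x: "x \<in> R" for R x
    proof -
      have "gam g P / emeasure lebesgue R \<le> 2 * gam g R / emeasure lebesgue R"
        using heavy R by (intro divide_right_mono_ennreal) auto
      also have "\<dots> = 2 * ((\<integral>\<^sup>+x\<in>R. absfun (dual_fun ?g) x \<partial>lebesgue) / emeasure lebesgue R)"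
        using heavy R set_nn_integral_dual_fun_restr[OF g, of R P] by (simp add: gam divide_ennreal_def mult.assoc)
      also have "\<dots> \<le> ?k x"
        using R x S by (intro mult_left_mono dyadic_maximal_upper) auto
      finally show ?thesis .
    qed
    have "sum (pair_term f g) S \<le> (\<Sum>R\<in>S. (\<integral>\<^sup>+x\<in>R. absfun f x \<partial>lebesgue) * gam g P / emeasure lebesgue R)"
      unfolding pair_term_def gam[symmetric]
      using heavy by (intro sum_mono divide_right_mono_ennreal mult_left_mono gam_mono) auto
    also have "\<dots> \<le> (\<Sum>R\<in>S. (\<integral>\<^sup>+x\<in>R. absfun f x \<partial>lebesgue) * gam g P / emeasure lebesgue R)
        + (\<integral>\<^sup>+x\<in>T. absfun f x \<partial>lebesgue) * gam g P / emeasure lebesgue T"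
      by simp
    also have "\<dots> \<le> 2 * (\<integral>\<^sup>+x\<in>T. absfun f x * ?k x \<partial>lebesgue)"
      using geometric_chain_grid[OF S(2-4)] T k by (intro chain_kernel_bound) auto
    also have "\<dots> \<le> 2 * (\<integral>\<^sup>+x. 2 * (absfun (restr P f) x * dyadic_maximal D (dual_fun ?g) x) \<partial>lebesgue)"
      using heavy T(1) by (intro mult_left_mono nn_integral_mono) (auto simp: absfun_restr mult_ac split: split_indicator)
    also have "\<dots> = 4 * (\<integral>\<^sup>+x. absfun (restr P f) x * dyadic_maximal D (dual_fun ?g) x \<partial>lebesgue)"
      unfolding absfun_restr by (subst nn_integral_cmult) (auto simp flip: mult.assoc)
    also have "\<dots> \<le> 4 * (ennreal A * ennpowr (nu (restr P f) UNIV) (1 / p) * ennpowr (gam ?g UNIV) (1 / q'))"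
      using dual_pairing[OF A restr_Lspace[OF f] test_fun_restr[OF g]] by (intro mult_left_mono) auto
    also have "\<dots> = ennreal (4 * A) * ennpowr (nu f P) (1 / p) * ennpowr (gam g P) (1 / q')"
      unfolding nu_restr gam_restr using A by (simp add: dual_bound_def ennreal_mult mult_ac)
    finally show ?thesis .
  qed simp
qed

text \<open>For general g the integrals of g u may vary along the chain, so the averages of f and of
  g u are both dominated by maximal functions. The two pairings contribute A and A', and
  \<open>chain_product_bound\<close> the factor 2.\<close>

lemma heavy_chain_bound_both:
  assumes A: "dual_bound A" and A': "primal_bound A'" and f: "f \<in> Lspace p v" and g: "test_fun g"
  shows "heavy_chain_bound (2 * (A + A')) f g"
  unfolding heavy_chain_bound_def
proof (intro allI impI)
  fix P S assume S: "P \<in> D" "finite S" "S \<subseteq> D" "nested S" and heavy: "\<forall>R\<in>S. R \<subseteq> P \<and> gam g P \<le> 2 * gam g R"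
  have [measurable]: "g \<in> borel_measurable lebesgue" "f \<in> borel_measurable lebesgue" "P \<in> sets lebesgue"
    using f g S(1) sets_cube by (auto simp: test_fun_def Lspace_def)
  note [measurable] = measurable_absfun
  show "sum (pair_term f g) S \<le> ennreal (2 * (A + A')) * ennpowr (nu f P) (1 / p) * ennpowr (gam g P) (1 / q')"
  proof (cases "S = {}")
    case False
    then obtain T where T: "T \<in> S" "\<And>R. R \<in> S \<Longrightarrow> R \<subseteq> T"
      using nested_has_top S by metis
    let ?g = "\<lambda>x. g x * indicator P x"
    let ?Mg = "dyadic_maximal D (dual_fun ?g)" and ?Mf = "dyadic_maximal D (restr P f)"
    have Mf: "(\<integral>\<^sup>+x\<in>R. absfun f x \<partial>lebesgue) / emeasure lebesgue R \<le> ?Mf x" if "R \<in> S" "x \<in> R" for R x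
      using dyadic_maximal_upper[of R x "restr P f"] set_nn_integral_restr[of R P f] that S heavy by auto
    have Mg: "(\<integral>\<^sup>+x\<in>R. g x * u x \<partial>lebesgue) / emeasure lebesgue R \<le> ?Mg x" if "R \<in> S" "x \<in> R" for R x
      using dyadic_maximal_upper[of R x "dual_fun ?g"] set_nn_integral_dual_fun_restr[OF g, of R P] that S heavy by auto
    have "sum (pair_term f g) S
        \<le> sum (pair_term f g) S + (\<integral>\<^sup>+x\<in>T. absfun f x \<partial>lebesgue) * (\<integral>\<^sup>+x\<in>T. g x * u x \<partial>lebesgue) / emeasure lebesgue T"
      by simp
    also have "\<dots> \<le> 2 * (\<integral>\<^sup>+x\<in>T. absfun f x * ?Mg x + g x * u x * ?Mf x \<partial>lebesgue)"
      unfolding pair_term_def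
      using geometric_chain_grid[OF S(2-4)] T Mf Mg by (intro chain_product_bound) auto
    also have "\<dots> \<le> 2 * (\<integral>\<^sup>+x. absfun (restr P f) x * ?Mg x + ?g x * u x * ?Mf x \<partial>lebesgue)"
      using heavy T(1) by (intro mult_left_mono nn_integral_mono) (auto simp: absfun_restr split: split_indicator)
    also have "\<dots> = 2 * ((\<integral>\<^sup>+x. absfun (restr P f) x * ?Mg x \<partial>lebesgue) + (\<integral>\<^sup>+x. ?g x * u x * ?Mf x \<partial>lebesgue))"
      unfolding absfun_restr by (subst nn_integral_add) auto
    also have "\<dots> \<le> 2 * (ennreal A * ennpowr (nu (restr P f) UNIV) (1 / p) * ennpowr (gam ?g UNIV) (1 / q')
        + ennreal A' * ennpowr (nu (restr P f) UNIV) (1 / p) * ennpowr (gam ?g UNIV) (1 / q'))"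
      using dual_pairing[OF A restr_Lspace[OF f] test_fun_restr[OF g]]
        primal_pairing[OF A' restr_Lspace[OF f] test_fun_restr[OF g]] by (intro mult_left_mono add_mono) auto
    also have "\<dots> = ennreal (2 * (A + A')) * ennpowr (nu f P) (1 / p) * ennpowr (gam g P) (1 / q')"
      unfolding nu_restr gam_restr using A A'
      by (simp add: dual_bound_def primal_bound_def ennreal_mult distrib_right distrib_left mult.assoc)
    finally show ?thesis .
  qed simp
qed

text \<open>The masses, being finite here, are passed to the recursion as reals. Its surplus
  exponent is 1/p + 1/q' - 1 = 1/p - 1/q; Tonelli and finite partial sums carry the result to the
  whole grid.\<close>

lemma bilinear_bound:
  assumes f: "f \<in> Lspace p v" and g: "test_fun g" and C: "0 \<le> C" "heavy_chain_bound C f g"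
  shows "(\<integral>\<^sup>+x. pos_op f x * (g x * u x) \<partial>lebesgue)
    \<le> ennreal (C / (1 - 2 powr (1 / q - 1 / p))) * ennpowr (nu f UNIV) (1 / p) * ennpowr (gam g UNIV) (1 / q')"
proof -
  have [measurable]: "g \<in> borel_measurable lebesgue" "f \<in> borel_measurable lebesgue"
    using f g by (auto simp: test_fun_def Lspace_def)
  note [measurable] = measurable_absfun
  define N where "N X = enn2real (nu f X)" for X
  define G where "G X = enn2real (gam g X)" for X
  have N: "nu f X = ennreal (N X)" "0 \<le> N X" for X
    using nu_finite[OF f, of X] by (auto simp: N_def less_top enn2real_nonneg)
  have G: "gam g X = ennreal (G X)" "0 \<le> G X" for X
    using gam_finite[OF g, of X] by (auto simp: G_def less_top enn2real_nonneg)
  have pow: "ennreal c * ennpowr (nu f X) (1 / p) * ennpowr (gam g X) (1 / q')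
      = ennreal (c * N X powr (1 / p) * G X powr (1 / q'))" if "0 \<le> c" for c X
    using p q'(1) N(2) G(2) that by (simp add: N(1) G(1) ennpowr_ennreal ennreal_mult)
  interpret T: tree_bound D N G "pair_term f g" "1 / p" "1 / q'" C
  proof
    show "laminar D" by (rule laminar_grid)
    show "0 < 1 / p" "1 / p < 1" using p by auto
    show "1 < 1 / p + 1 / q'" using p pq by (simp add: q'(2) frac_less2)
    show "0 \<le> C" by fact
    show "0 \<le> N X" "0 \<le> G X" for X by fact+
  next
    fix L X assume L: "finite L" "L \<subseteq> D" "disjoint L" "\<Union>L \<subseteq> X"
    have "(\<Sum>R\<in>L. nu f R) \<le> nu f X"
      unfolding nu_def using L sets_cube by (intro sum_set_nn_integral_le) auto
    then show "sum N L \<le> N X"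
      by (simp add: N sum_nonneg)
    have "(\<Sum>R\<in>L. gam g R) \<le> gam g X"
      unfolding gam_def using L sets_cube by (intro sum_set_nn_integral_le) auto
    then show "sum G L \<le> G X"
      by (simp add: G sum_nonneg)
  next
    fix R assume "R \<in> D" "G R = 0"
    then have "(\<integral>\<^sup>+x\<in>R. g x * u x \<partial>lebesgue) = 0"
      using sets_cube G by (intro gam_0D) auto
    then show "pair_term f g R = 0" by (simp add: pair_term_def)
  next
    fix P S assume S: "P \<in> D" "finite S" "S \<subseteq> D" "nested S" "\<And>R. R \<in> S \<Longrightarrow> R \<subseteq> P \<and> G P / 2 < G R"
    have "gam g P \<le> 2 * gam g R" if "R \<in> S" for R
    proof -
      have "G P \<le> 2 * G R" using S(5)[OF that] by simp
      then have "ennreal (G P) \<le> ennreal (2 * G R)" by (rule ennreal_leI)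
      then show ?thesis by (simp add: G ennreal_mult)
    qed
    then have "\<forall>R\<in>S. R \<subseteq> P \<and> gam g P \<le> 2 * gam g R" using S(5) by simp
    with C(2) S(1-4) have "sum (pair_term f g) S \<le> ennreal C * ennpowr (nu f P) (1 / p) * ennpowr (gam g P) (1 / q')"
      unfolding heavy_chain_bound_def by (elim allE impE) assumption+
    then show "sum (pair_term f g) S \<le> ennreal (C * N P powr (1 / p) * G P powr (1 / q'))"
      by (simp only: pow[OF C(1)])
  qed
  have "- (1 / p + 1 / q' - 1) = 1 / q - 1 / p" by (simp only: q'(2))
  then have const: "T.tree_const = C / (1 - 2 powr (1 / q - 1 / p))"
    by (simp only: T.tree_const_def)
  show ?thesis
    unfolding nn_integral_pos_op[OF \<open>g \<in> borel_measurable lebesgue\<close>] const[symmetric] pow[OF T.tree_const_nonneg]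
    by (intro nn_integral_count_space_le countable_grid T.tree_bound)
qed

end

section \<open>Bounds for the positive operator\<close>

text \<open>Absorption: dividing by m^(1 - 1/q) is legitimate because m is a real number, which is
  why the test functions must have finite mass.\<close>

lemma le_powr_of_self_bound:
  fixes m t c q :: real
  assumes "1 < q" "0 \<le> m" "0 < t" "0 \<le> c" "t * m \<le> c * m powr (1 - 1 / q)"
  shows "m \<le> (c / t) powr q"
proof (cases "m = 0")
  case False
  then have m: "m > 0" using assms by simp
  have "t * m = t * m powr (1 / q) * m powr (1 - 1 / q)"
    using m by (simp add: mult.assoc flip: powr_add)
  with assms(5) m have "t * m powr (1 / q) \<le> c" by simp
  then have "m powr (1 / q) \<le> c / t" using assms by (simp add: field_simps)
  then have "(m powr (1 / q)) powr q \<le> (c / t) powr q"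
    using assms by (intro powr_mono2) auto
  then show ?thesis using m assms by (simp add: powr_powr)
qed simp

lemma nn_integral_le_of_incseq:
  assumes "\<And>n. F n \<in> borel_measurable M" "incseq F" "\<And>n. (\<integral>\<^sup>+x. F n x \<partial>M) \<le> L"
    and "AE x in M. \<exists>n. f x \<le> F n x"
  shows "(\<integral>\<^sup>+x. f x \<partial>M) \<le> L"
proof -
  have "(\<integral>\<^sup>+x. f x \<partial>M) \<le> (\<integral>\<^sup>+x. (SUP n. F n x) \<partial>M)"
    using assms(4) by (intro nn_integral_mono_AE) (auto elim!: eventually_mono intro: SUP_upper2)
  also have "\<dots> = (SUP n. \<integral>\<^sup>+x. F n x \<partial>M)"
    using assms(1,2) by (rule nn_integral_monotone_convergence_SUP[rotated])
  also have "\<dots> \<le> L" using assms(3) by (intro SUP_least) auto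
  finally show ?thesis .
qed

section \<open>Weak and strong type estimates from test functions of finite mass\<close>

context two_weight
begin

text \<open>On these sets u is bounded and the domain is bounded, so u is integrable there; they
  increase to {u < \<infinity>}, that is, to almost the whole space.\<close>

definition level :: "nat \<Rightarrow> (real^'n) set" where
  "level n = cball 0 (real n) \<inter> {x. u x \<le> of_nat n}"

lemma sets_level [measurable]: "level n \<in> sets lebesgue"
proof -
  have "{x \<in> space lebesgue. u x \<le> of_nat n} \<in> sets lebesgue" by measurable
  then show ?thesis unfolding level_def by auto
qed

lemma level_mono: "m \<le> n \<Longrightarrow> level m \<subseteq> level n"
  unfolding level_def by (auto intro: order_trans)

lemma ex_level:
  assumes "u x < \<infinity>"
  obtains n where "x \<in> level n" "N \<le> n"
proof -
  obtain r where r: "u x = ennreal r" "0 \<le> r" using assms by (cases "u x") auto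
  define n where "n = max N (nat \<lceil>max r (norm x)\<rceil>)"
  have "real (nat \<lceil>max r (norm x)\<rceil>) \<ge> max r (norm x)" by linarith
  then have "r \<le> real n" "norm x \<le> real n" unfolding n_def by linarith+
  then have "x \<in> level n"
    by (auto simp: level_def r ennreal_of_nat_eq_real_of_nat intro: ennreal_leI)
  then show ?thesis using that by (simp add: n_def)
qed

lemma level_integral_finite: "(\<integral>\<^sup>+x\<in>level n. u x \<partial>lebesgue) < \<infinity>"
proof -
  have "(\<integral>\<^sup>+x\<in>level n. u x \<partial>lebesgue) \<le> (\<integral>\<^sup>+x. of_nat n * indicator (cball (0::real^'n) (real n)) x \<partial>lebesgue)"
    by (intro nn_integral_mono) (auto simp: level_def split: split_indicator)
  also have "\<dots> = of_nat n * emeasure lebesgue (cball 0 (real n) :: (real^'n) set)"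
    by (rule nn_integral_cmult_indicator) simp
  also have "\<dots> < \<infinity>"
    using fmeasurableD2[OF lmeasurable_cball[of "0::real^'n" "real n"]]
    by (simp add: ennreal_mult_less_top of_nat_less_top less_top del: emeasure_completion)
  finally show ?thesis .
qed

definition op_const :: "real \<Rightarrow> real" where
  "op_const C = C / (1 - 2 powr (1 / q - 1 / p))"

lemma op_const_nonneg: "0 \<le> C \<Longrightarrow> 0 \<le> op_const C"
proof -
  have "1 / q < 1 / p" using p pq by (simp add: frac_less2)
  then have "2 powr (1 / q - 1 / p) < (1::real)"
    using powr_less_one[of 2 "1 / q - 1 / p"] by simp
  then show "0 \<le> C \<Longrightarrow> 0 \<le> op_const C" by (simp add: op_const_def)
qed

text \<open>The common end of both estimates: the pairing of T f with g u is at least t times the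
  mass of g and at most a multiple of its power 1 - 1/q, so the mass can be absorbed. The weak type
  uses the height t of the level set, the strong type t = 1.\<close>

lemma self_bound:
  assumes f: "f \<in> Lspace p v" and g: "test_fun g" and C: "0 \<le> C" "heavy_chain_bound C f g"
    and t: "0 < t" and le: "ennreal t * gam g UNIV \<le> (\<integral>\<^sup>+x. pos_op f x * (g x * u x) \<partial>lebesgue)"
  shows "gam g UNIV \<le> ennpowr (ennreal (op_const C / t) * Lnorm p v (absfun f)) q"
proof -
  obtain m where m: "gam g UNIV = ennreal m" "0 \<le> m"
    using gam_finite[OF g, of UNIV] by (cases "gam g UNIV") auto
  obtain N where N: "Lnorm p v (absfun f) = ennreal N" "0 \<le> N"
    using f by (cases "Lnorm p v (absfun f)") (auto simp: Lspace_def)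
  have K: "0 \<le> op_const C" using C op_const_nonneg by simp
  have "ennreal (t * m) = ennreal t * gam g UNIV" using m t by (simp add: ennreal_mult)
  also have "\<dots> \<le> ennreal (op_const C) * Lnorm p v (absfun f) * ennpowr (gam g UNIV) (1 / q')"
    unfolding Lnorm_nu op_const_def using order_trans[OF le bilinear_bound[OF f g C]] .
  also have "\<dots> = ennreal (op_const C * N * m powr (1 - 1 / q))"
    unfolding q'(2) using q m(2) N(2) K by (simp add: m(1) N(1) ennpowr_ennreal ennreal_mult)
  finally have "t * m \<le> op_const C * N * m powr (1 - 1 / q)"
    using K N by (subst (asm) ennreal_le_iff) auto
  then have "m \<le> (op_const C * N / t) powr q"
    using q m t K N by (intro le_powr_of_self_bound) auto
  moreover have "ennpowr (ennreal (op_const C / t) * ennreal N) q = ennreal ((op_const C * N / t) powr q)"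
    using q K N t by (simp add: ennpowr_ennreal flip: ennreal_mult)
  ultimately show ?thesis unfolding m N(1) by (simp add: ennreal_leI)
qed

theorem weak_bound:
  assumes A: "dual_bound A" and f: "f \<in> Lspace p v"
  shows "weak_Lnorm q u (pos_op f) \<le> ennreal (op_const (4 * A)) * Lnorm p v (absfun f)"
  unfolding weak_Lnorm_def
proof (rule SUP_least)
  fix t :: real assume "t \<in> {0<..}"
  then have t: "0 < t" by simp
  have A0: "0 \<le> 4 * A" using A by (simp add: dual_bound_def)
  let ?U = "{x. pos_op f x > ennreal t}"
  let ?B = "ennpowr (ennreal (op_const (4 * A) / t) * Lnorm p v (absfun f)) q"
  have "{x \<in> space lebesgue. pos_op f x > ennreal t} \<in> sets lebesgue" by measurable
  then have [measurable]: "?U \<in> sets lebesgue" by simp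
  have bound: "(\<integral>\<^sup>+x. u x * indicator (?U \<inter> level n) x \<partial>lebesgue) \<le> ?B" for n
  proof -
    \<comment> \<open>On the level set T f exceeds t, so its indicator satisfies the hypothesis of
      \<open>self_bound\<close>; intersecting with \<open>level n\<close> makes the mass
      finite.\<close>
    let ?g = "\<lambda>x. indicator (?U \<inter> level n) x :: ennreal"
    have gam: "gam ?g UNIV = (\<integral>\<^sup>+x. u x * indicator (?U \<inter> level n) x \<partial>lebesgue)"
      unfolding gam_def using q'(1) ennpowr_ennreal[of q' 1]
      by (intro nn_integral_cong) (auto simp: ennpowr_zero split: split_indicator)
    have "gam ?g UNIV \<le> (\<integral>\<^sup>+x\<in>level n. u x \<partial>lebesgue)"
      unfolding gam by (intro nn_integral_mono) (auto split: split_indicator)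
    then have "gam ?g UNIV < \<infinity>" using level_integral_finite by (rule le_less_trans)
    then have g: "test_fun ?g" by (auto simp: test_fun_def split: split_indicator)
    have "ennreal t * gam ?g UNIV = (\<integral>\<^sup>+x. ennreal t * (u x * indicator (?U \<inter> level n) x) \<partial>lebesgue)"
      unfolding gam by (rule nn_integral_cmult[symmetric]) measurable
    also have "\<dots> \<le> (\<integral>\<^sup>+x. pos_op f x * (?g x * u x) \<partial>lebesgue)"
      by (intro nn_integral_mono) (auto split: split_indicator intro: mult_right_mono)
    finally show ?thesis
      unfolding gam[symmetric]
      by (intro self_bound[OF f g A0 _ t] heavy_chain_bound_dual[OF A f g]) (auto split: split_indicator)
  qed
  have "(\<integral>\<^sup>+x\<in>?U. u x \<partial>lebesgue) \<le> ?B"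
  proof (rule nn_integral_le_of_incseq[OF _ _ bound])
    show "incseq (\<lambda>n x. u x * indicator (?U \<inter> level n) x)"
      using level_mono by (fastforce simp: incseq_def le_fun_def split: split_indicator)
    show "AE x in lebesgue. \<exists>n. u x * indicator ?U x \<le> u x * indicator (?U \<inter> level n) x"
      using u_finite
    proof eventually_elim
      case (elim x)
      then obtain n where "x \<in> level n" using ex_level[of x 0] by blast
      then show ?case by (intro exI[of _ n]) (auto split: split_indicator)
    qed
  qed measurable
  then have "ennreal t * ennpowr (\<integral>\<^sup>+x\<in>?U. u x \<partial>lebesgue) (1 / q) \<le> ennreal t * ennpowr ?B (1 / q)"
    using q by (intro mult_left_mono ennpowr_mono) auto
  also have "\<dots> = ennreal t * (ennreal (op_const (4 * A) / t) * Lnorm p v (absfun f))"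
    using q by (simp add: ennpowr_ennpowr ennpowr_one)
  also have "\<dots> = ennreal (op_const (4 * A)) * Lnorm p v (absfun f)"
    using t op_const_nonneg[OF A0] by (simp flip: ennreal_mult mult.assoc)
  finally show "ennreal t * ennpowr (\<integral>\<^sup>+x\<in>?U. u x \<partial>lebesgue) (1 / q)
    \<le> ennreal (op_const (4 * A)) * Lnorm p v (absfun f)" .
qed

text \<open>The set where T f is infinite lies in every superlevel set, so the weak bound makes t
  m^(1/q) bounded in t for its u-measure m, whence m = 0.\<close>

lemma pos_op_finite:
  assumes A: "dual_bound A" and f: "f \<in> Lspace p v"
  shows "AE x in lebesgue. 0 < u x \<longrightarrow> pos_op f x < \<infinity>"
proof -
  obtain B where B: "ennreal (op_const (4 * A)) * Lnorm p v (absfun f) = ennreal B" "0 \<le> B"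
    using f by (cases "ennreal (op_const (4 * A)) * Lnorm p v (absfun f)")
      (auto simp: Lspace_def ennreal_mult_eq_top_iff)
  let ?U = "{x. pos_op f x = \<infinity>}"
  have "{x \<in> space lebesgue. pos_op f x = \<infinity>} \<in> sets lebesgue" by measurable
  then have [measurable]: "?U \<in> sets lebesgue" by simp
  let ?m = "\<integral>\<^sup>+x\<in>?U. u x \<partial>lebesgue"
  have le: "ennreal t * ennpowr ?m (1 / q) \<le> ennreal B" if "0 < t" for t
  proof -
    have "ennreal t * ennpowr ?m (1 / q) \<le> ennreal t * ennpowr (\<integral>\<^sup>+x\<in>{x. pos_op f x > ennreal t}. u x \<partial>lebesgue) (1 / q)"
      using q by (intro mult_left_mono ennpowr_mono nn_integral_mono) (auto split: split_indicator)
    also have "\<dots> \<le> weak_Lnorm q u (pos_op f)"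
      unfolding weak_Lnorm_def using that by (intro SUP_upper) auto
    also have "\<dots> \<le> ennreal B" using weak_bound[OF A f] B by simp
    finally show ?thesis .
  qed
  have "ennpowr ?m (1 / q) = 0"
  proof (cases "ennpowr ?m (1 / q)")
    case (real s)
    have "t * s \<le> B" if "0 < t" for t
      using le[OF that] that real B by (simp flip: ennreal_mult)
    \<comment> \<open>For s > 0 this value of t would give B + 1 \<le> B.\<close>
    from this[of "(B + 1) / s"] show ?thesis
      using real B by (cases "s = 0") (auto simp: field_simps split: if_splits)
  next
    case top
    then show ?thesis using le[of 1] by (simp add: top_unique)
  qed
  then have "?m = 0" using q by (simp add: ennpowr_eq_0_iff)
  then have "AE x in lebesgue. u x * indicator ?U x = 0"
    by (subst (asm) nn_integral_0_iff_AE) auto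
  then show ?thesis
    by eventually_elim (auto simp: less_top split: split_indicator_asm)
qed

theorem strong_bound:
  assumes A: "dual_bound A" and A': "primal_bound A'" and f: "f \<in> Lspace p v"
  shows "Lnorm q u (pos_op f) \<le> ennreal (op_const (2 * (A + A'))) * Lnorm p v (absfun f)"
proof -
  let ?C = "2 * (A + A')"
  have C0: "0 \<le> ?C" using A A' by (simp add: dual_bound_def primal_bound_def)
  let ?B = "ennpowr (ennreal (op_const ?C) * Lnorm p v (absfun f)) q"
  define h where "h n x = min (pos_op f x) (of_nat n) * indicator (level n) x" for n x
  have [measurable]: "h n \<in> borel_measurable lebesgue" for n
    unfolding h_def[abs_def] by measurable
  have h_le: "h n x \<le> pos_op f x" "h n x \<le> of_nat n" for n x
    unfolding h_def by (auto split: split_indicator)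
  \<comment> \<open>Reason for testing with h^(q - 1): its mass is the integral of h^q u, and
    pairing it with h gives the same integral.\<close>
  have qq: "(q - 1) * q' = q" using q by (simp add: conj_exp_def)
  have bound: "(\<integral>\<^sup>+x. ennpowr (h n x) q * u x \<partial>lebesgue) \<le> ?B" for n
  proof -
    let ?g = "\<lambda>x. ennpowr (h n x) (q - 1)"
    have gam: "gam ?g UNIV = (\<integral>\<^sup>+x. ennpowr (h n x) q * u x \<partial>lebesgue)"
      unfolding gam_def using q q'(1) by (simp add: ennpowr_ennpowr qq)
    have "gam ?g UNIV \<le> (\<integral>\<^sup>+x. ennpowr (of_nat n) q * (u x * indicator (level n) x) \<partial>lebesgue)"
      unfolding gam
    proof (rule nn_integral_mono)
      fix x
      show "ennpowr (h n x) q * u x \<le> ennpowr (of_nat n) q * (u x * indicator (level n) x)"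
        using q by (cases "x \<in> level n") (auto simp: h_def ennpowr_zero intro!: mult_right_mono ennpowr_mono)
    qed
    also have "\<dots> = ennpowr (of_nat n) q * (\<integral>\<^sup>+x\<in>level n. u x \<partial>lebesgue)"
      by (rule nn_integral_cmult) measurable
    also have "\<dots> < \<infinity>"
      using level_integral_finite[of n] q by (simp add: ennreal_mult_less_top ennpowr_less_top of_nat_less_top)
    finally have "gam ?g UNIV < \<infinity>" .
    moreover have "h n x < \<infinity>" for x
      using h_le(2)[of n x] by (simp add: le_less_trans of_nat_less_top)
    ultimately have g: "test_fun ?g"
      using q by (auto simp: test_fun_def ennpowr_less_top)
    have "ennreal 1 * gam ?g UNIV = (\<integral>\<^sup>+x. h n x * (?g x * u x) \<partial>lebesgue)"
    proof -
      have "ennpowr t q = t * ennpowr t (q - 1)" if "t < \<infinity>" for t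
        using q ennpowr_add[of t 1 "q - 1"] that
        by (cases "t = 0") (auto simp: ennpowr_zero ennpowr_one zero_less_iff_neq_zero)
      with \<open>\<And>x. h n x < \<infinity>\<close> show ?thesis unfolding gam by (simp add: mult.assoc)
    qed
    also have "\<dots> \<le> (\<integral>\<^sup>+x. pos_op f x * (?g x * u x) \<partial>lebesgue)"
      using h_le(1) by (intro nn_integral_mono mult_right_mono) auto
    finally show ?thesis
      using self_bound[OF f g C0 heavy_chain_bound_both[OF A A' f g], of 1] unfolding gam by simp
  qed
  have "(\<integral>\<^sup>+x. ennpowr (pos_op f x) q * u x \<partial>lebesgue) \<le> ?B"
  proof (rule nn_integral_le_of_incseq[OF _ _ bound])
    show "incseq (\<lambda>n x. ennpowr (h n x) q * u x)"
      unfolding incseq_def le_fun_def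
    proof (intro allI impI mult_right_mono ennpowr_mono)
      fix m n :: nat and x assume "m \<le> n"
      then show "h m x \<le> h n x"
        using level_mono[OF \<open>m \<le> n\<close>] unfolding h_def
        by (intro mult_mono min.mono) (auto split: split_indicator)
    qed (use q in auto)
    \<comment> \<open>Where T f and u are finite, the cut-off is exact as soon as n exceeds the
      value of T f and x lies in \<open>level n\<close>.\<close>
    show "AE x in lebesgue. \<exists>n. ennpowr (pos_op f x) q * u x \<le> ennpowr (h n x) q * u x"
      using u_finite pos_op_finite[OF A f]
    proof eventually_elim
      case (elim x)
      show ?case
      proof (cases "u x = 0")
        case False
        then have "pos_op f x < \<infinity>" using elim by (simp add: zero_less_iff_neq_zero)
        then obtain r where r: "pos_op f x = ennreal r" "0 \<le> r" by (cases "pos_op f x") auto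
        obtain n where n: "x \<in> level n" "nat \<lceil>r\<rceil> \<le> n"
          using ex_level[OF elim(1), of "nat \<lceil>r\<rceil>"] by blast
        then have "r \<le> real n" by linarith
        then have "h n x = pos_op f x"
          using n r by (simp add: h_def ennreal_of_nat_eq_real_of_nat min_absorb1 ennreal_leI)
        then show ?thesis by (intro exI[of _ n]) simp
      qed simp
    qed
  qed measurable
  then have "Lnorm q u (pos_op f) \<le> ennpowr ?B (1 / q)"
    unfolding Lnorm_def using q by (intro ennpowr_mono) auto
  then show ?thesis using q by (simp add: ennpowr_ennpowr ennpowr_one)
qed

end

section \<open>Domination of the shift by the positive operator\<close>

text \<open>If the product is not integrable, the Bochner integral takes the default value 0 and the
  bound is trivial.\<close>

lemma norm_pairing_le:
  assumes "\<And>x. x \<notin> Q \<Longrightarrow> g x = 0" "\<And>x. norm (g x) \<le> 1"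
  shows "ennreal (norm (pairing f g)) \<le> (\<integral>\<^sup>+x\<in>Q. absfun f x \<partial>lebesgue)"
proof (cases "integrable lebesgue (\<lambda>y. f y * cnj (g y))")
  case True
  then have "ennreal (norm (pairing f g)) \<le> (\<integral>\<^sup>+y. ennreal (norm (f y * cnj (g y))) \<partial>lebesgue)"
    unfolding pairing_def by (rule integral_norm_bound_ennreal)
  also have "\<dots> \<le> (\<integral>\<^sup>+x\<in>Q. absfun f x \<partial>lebesgue)"
  proof (rule nn_integral_mono)
    fix y
    have "norm (f y) * norm (g y) \<le> norm (f y)" using assms(2)[of y] by (simp add: mult_left_le)
    then show "ennreal (norm (f y * cnj (g y))) \<le> absfun f y * indicator Q y"
      using assms(1)[of y] by (cases "y \<in> Q") (auto simp: absfun_def norm_mult intro: ennreal_leI)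
  qed
  finally show ?thesis .
qed (simp add: pairing_def not_integrable_integral_eq)

lemma ennreal_norm_sum_le:
  fixes f :: "'a \<Rightarrow> 'b::real_normed_vector"
  assumes "\<And>i. i \<in> I \<Longrightarrow> ennreal (norm (f i)) \<le> b i"
  shows "ennreal (norm (\<Sum>i\<in>I. f i)) \<le> (\<Sum>i\<in>I. b i)"
proof -
  have "ennreal (norm (\<Sum>i\<in>I. f i)) \<le> ennreal (\<Sum>i\<in>I. norm (f i))"
    by (intro ennreal_leI norm_sum)
  also have "\<dots> = (\<Sum>i\<in>I. ennreal (norm (f i)))" by simp
  also have "\<dots> \<le> (\<Sum>i\<in>I. b i)" using assms by (rule sum_mono)
  finally show ?thesis .
qed

section \<open>Pointwise control of the pieces, the truncations and their limit\<close>

context grid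
begin

definition avg :: "((real^'n) \<Rightarrow> complex) \<Rightarrow> (real^'n) set \<Rightarrow> ennreal" where
  "avg f Q = (\<integral>\<^sup>+y\<in>Q. absfun f y \<partial>lebesgue) / emeasure lebesgue Q"

definition haar_families :: "nat \<Rightarrow> nat \<Rightarrow> 'n haar_family \<Rightarrow> 'n haar_family \<Rightarrow> bool" where
  "haar_families m k g h \<longleftrightarrow>
    (\<forall>Q\<in>D. \<forall>Q'\<in>descendants D m Q. \<forall>Q''\<in>descendants D k Q.
        gen_haar D Q' (g Q' Q'') \<and> gen_haar D Q'' (h Q'' Q'))"

lemma disjoint_descendants: "disjoint (descendants D m Q)"
  unfolding disjoint_def
proof (intro ballI impI)
  fix R R' assume "R \<in> descendants D m Q" "R' \<in> descendants D m Q" "R \<noteq> R'"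
  then show "R \<inter> R' = {}" using same_side[of R R'] unfolding descendants_def by auto
qed

text \<open>Descendants of one generation are disjoint, so at most one indicator is nonzero at x;
  for an infinite index set the default value 0 of \<open>sum\<close> also satisfies the
  bound.\<close>

lemma sum_indicator_descendants_le: "(\<Sum>R\<in>descendants D k Q. indicator R x) \<le> (1::ennreal)"
proof (cases "finite (descendants D k Q) \<and> (\<exists>R\<in>descendants D k Q. x \<in> R)")
  case True
  then obtain R where R: "R \<in> descendants D k Q" "x \<in> R" by blast
  have "(\<Sum>R\<in>descendants D k Q. indicator R x) = (\<Sum>R\<in>{R}. indicator R x :: ennreal)"
    using True R disjoint_descendants[of k Q]
    by (intro sum.mono_neutral_right) (auto simp: disjoint_def indicator_def)
  then show ?thesis using R by simp
next
  case False
  then have "(\<Sum>R\<in>descendants D k Q. indicator R x) = (0::ennreal)"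
    by (cases "finite (descendants D k Q)") (auto intro!: sum.neutral split: split_indicator)
  then show ?thesis by simp
qed

text \<open>At most one Q'' contains x, while the disjoint Q' have integrals adding up to at most
  that over Q. The number of descendants therefore never enters, and the bound is uniform in m and
  k.\<close>

lemma norm_shift_piece_le:
  assumes fam: "haar_families m k g h" and Q: "Q \<in> D" and f: "f \<in> borel_measurable lebesgue"
  shows "ennreal (norm (shift_piece D m k g h Q f x)) \<le> avg f Q * indicator Q x"
proof -
  have [measurable]: "absfun f \<in> borel_measurable lebesgue"
    using f unfolding absfun_def[abs_def] by measurable
  have "emeasure lebesgue Q = ennreal (measure lebesgue Q)"
    using emeasure_cube_finite[OF Q] by (intro emeasure_eq_ennreal_measure) auto
  moreover from this have meas: "0 < measure lebesgue Q"
    using emeasure_cube_pos[OF Q] by (auto simp: zero_less_measure_iff)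
  ultimately have mQ: "ennreal (t / measure lebesgue Q) = ennreal t / emeasure lebesgue Q" if "0 \<le> t" for t
    using that by (simp add: divide_ennreal)
  let ?a = "\<lambda>R. \<integral>\<^sup>+y\<in>R. absfun f y \<partial>lebesgue"
  have summand: "ennreal (norm (pairing f (g Q' Q'') / of_real (measure lebesgue Q) * h Q'' Q' x))
      \<le> ?a Q' / emeasure lebesgue Q * indicator Q'' x"
    if "Q' \<in> descendants D m Q" "Q'' \<in> descendants D k Q" for Q' Q''
  proof -
    have haar: "gen_haar D Q' (g Q' Q'')" "gen_haar D Q'' (h Q'' Q')"
      using fam Q that unfolding haar_families_def by auto
    have h: "ennreal (norm (h Q'' Q' x)) \<le> indicator Q'' x"
      using haar(2) unfolding gen_haar_def by (cases "x \<in> Q''") (auto simp: ennreal_le_1)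
    have "ennreal (norm (pairing f (g Q' Q''))) \<le> ?a Q'"
      using haar(1) unfolding gen_haar_def by (intro norm_pairing_le) auto
    then have "ennreal (norm (pairing f (g Q' Q''))) / emeasure lebesgue Q * ennreal (norm (h Q'' Q' x))
        \<le> ?a Q' / emeasure lebesgue Q * indicator Q'' x"
      using h by (intro mult_mono divide_right_mono_ennreal) auto
    moreover have "ennreal (norm (pairing f (g Q' Q'') / of_real (measure lebesgue Q) * h Q'' Q' x))
        = ennreal (norm (pairing f (g Q' Q''))) / emeasure lebesgue Q * ennreal (norm (h Q'' Q' x))"
      using meas by (simp add: norm_mult norm_divide ennreal_mult mQ) (simp add: divide_ennreal_def mult_ac)
    ultimately show ?thesis by simp
  qed
  show ?thesis
  proof (cases "x \<in> Q")
    case False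
    then have "h Q'' Q' x = 0" if "Q' \<in> descendants D m Q" "Q'' \<in> descendants D k Q" for Q' Q''
      using fam Q that unfolding haar_families_def gen_haar_def descendants_def by blast
    then have "shift_piece D m k g h Q f x = 0"
      unfolding shift_piece_def by (intro sum.neutral ballI) simp
    then show ?thesis by simp
  next
    case True
    have "ennreal (norm (shift_piece D m k g h Q f x))
        \<le> (\<Sum>Q'\<in>descendants D m Q. \<Sum>Q''\<in>descendants D k Q. ?a Q' / emeasure lebesgue Q * indicator Q'' x)"
      unfolding shift_piece_def by (intro ennreal_norm_sum_le summand)
    also have "\<dots> \<le> (\<Sum>Q'\<in>descendants D m Q. ?a Q' / emeasure lebesgue Q * 1)"
      unfolding sum_distrib_left[symmetric]
      by (intro sum_mono mult_left_mono sum_indicator_descendants_le) auto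
    also have "\<dots> = (\<Sum>Q'\<in>descendants D m Q. ?a Q') / emeasure lebesgue Q"
      by (simp add: divide_ennreal_def sum_distrib_right)
    also have "\<dots> \<le> avg f Q"
      unfolding avg_def
    proof (rule divide_right_mono_ennreal)
      show "(\<Sum>Q'\<in>descendants D m Q. ?a Q') \<le> ?a Q"
      proof (cases "finite (descendants D m Q)")
        case True
        then show ?thesis
          using disjoint_descendants sets_cube
          by (intro sum_set_nn_integral_le) (auto simp: descendants_def)
      qed simp
    qed
    finally show ?thesis using True by simp
  qed
qed

definition scale_range :: "real \<Rightarrow> real \<Rightarrow> (real^'n) \<Rightarrow> (real^'n) set set" where
  "scale_range e e' x = {Q\<in>D. x \<in> Q \<and> e \<le> side_length Q \<and> side_length Q \<le> e'}"

text \<open>A point lies in only one cube of each side length, and the exponents of the admissible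
  sides lie between log e and log e'.\<close>

lemma finite_scale_range:
  assumes "0 < e"
  shows "finite (scale_range e e' x)"
proof -
  have "\<exists>k::int. side_length Q = 2 powi k" if "Q \<in> D" for Q
    using side_length_powi[OF that] by metis
  then obtain s :: "(real^'n) set \<Rightarrow> int" where s: "\<And>Q. Q \<in> D \<Longrightarrow> side_length Q = 2 powi s Q"
    by metis
  have "inj_on s (scale_range e e' x)"
  proof (rule inj_onI)
    fix Q R assume "Q \<in> scale_range e e' x" "R \<in> scale_range e e' x" "s Q = s R"
    then show "Q = R" using s same_side[of Q R x] by (simp add: scale_range_def)
  qed
  moreover have "s ` scale_range e e' x \<subseteq> {\<lfloor>log 2 e\<rfloor>..\<lceil>log 2 e'\<rceil>}"
  proof
    fix k assume "k \<in> s ` scale_range e e' x"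
    then have k: "e \<le> 2 powi k" "2 powi k \<le> e'"
      using s by (auto simp: scale_range_def)
    have "0 < e'" using assms k by linarith
    have "log 2 e \<le> of_int k" "of_int k \<le> log 2 e'"
      using k assms \<open>0 < e'\<close> by (simp_all add: log_le_iff le_log_iff powr_real_of_int')
    then show "k \<in> {\<lfloor>log 2 e\<rfloor>..\<lceil>log 2 e'\<rceil>}" by (simp; linarith)
  qed
  ultimately show ?thesis by (meson finite_atLeastAtMost_int finite_imageD finite_subset)
qed

text \<open>Pieces of cubes not containing x vanish at x, so the infinite sum collapses to finitely
  many terms.\<close>

lemma shift_trunc_eq_sum:
  assumes "haar_families m k g h" "f \<in> borel_measurable lebesgue" "0 < e"
  shows "shift_trunc D m k g h e e' f x = (\<Sum>Q\<in>scale_range e e' x. shift_piece D m k g h Q f x)"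
proof -
  have "shift_piece D m k g h Q f x = 0" if "Q \<in> D" "x \<notin> Q" for Q
    using norm_shift_piece_le[OF assms(1) that(1) assms(2), of x] that(2) by simp
  then have "shift_trunc D m k g h e e' f x = infsum (\<lambda>Q. shift_piece D m k g h Q f x) (scale_range e e' x)"
    unfolding shift_trunc_def by (intro infsum_cong_neutral) (auto simp: scale_range_def)
  also have "\<dots> = (\<Sum>Q\<in>scale_range e e' x. shift_piece D m k g h Q f x)"
    using finite_scale_range[OF assms(3)] by simp
  finally show ?thesis .
qed

lemma pos_op_upper:
  assumes "finite S" "S \<subseteq> D"
  shows "(\<Sum>Q\<in>S. avg f Q * indicator Q x) \<le> pos_op f x"
proof -
  have "(\<Sum>Q\<in>S. avg f Q * indicator Q x) = (\<integral>\<^sup>+Q. avg f Q * indicator Q x \<partial>count_space S)"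
    using assms(1) by (simp add: nn_integral_count_space_finite)
  also have "\<dots> = (\<integral>\<^sup>+Q. avg f Q * indicator Q x * indicator S Q \<partial>count_space UNIV)"
    by (subst nn_integral_count_space_indicator) auto
  also have "\<dots> \<le> (\<integral>\<^sup>+Q. avg f Q * indicator Q x * indicator D Q \<partial>count_space UNIV)"
    using assms(2) by (intro nn_integral_mono) (auto split: split_indicator)
  also have "\<dots> = pos_op f x"
    unfolding pos_op_def avg_def by (subst (2) nn_integral_count_space_indicator) auto
  finally show ?thesis .
qed

lemma sum_norm_shift_piece_le:
  assumes "haar_families m k g h" "f \<in> borel_measurable lebesgue" "finite S" "S \<subseteq> D"
  shows "ennreal (\<Sum>Q\<in>S. norm (shift_piece D m k g h Q f x)) \<le> pos_op f x"
proof -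
  have "ennreal (\<Sum>Q\<in>S. norm (shift_piece D m k g h Q f x)) = (\<Sum>Q\<in>S. ennreal (norm (shift_piece D m k g h Q f x)))"
    by simp
  also have "\<dots> \<le> (\<Sum>Q\<in>S. avg f Q * indicator Q x)"
    using assms by (intro sum_mono norm_shift_piece_le) auto
  also have "\<dots> \<le> pos_op f x" using assms(3,4) by (rule pos_op_upper)
  finally show ?thesis .
qed

lemma norm_shift_trunc_le:
  assumes "haar_families m k g h" "f \<in> borel_measurable lebesgue" "0 < e"
  shows "ennreal (norm (shift_trunc D m k g h e e' f x)) \<le> pos_op f x"
proof -
  have "ennreal (norm (shift_trunc D m k g h e e' f x))
      \<le> ennreal (\<Sum>Q\<in>scale_range e e' x. norm (shift_piece D m k g h Q f x))"
    unfolding shift_trunc_eq_sum[OF assms] by (intro ennreal_leI norm_sum)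
  also have "\<dots> \<le> pos_op f x"
    using assms finite_scale_range by (intro sum_norm_shift_piece_le) (auto simp: scale_range_def)
  finally show ?thesis .
qed

lemma haar_shift_star_le:
  assumes "haar_families m k g h" "f \<in> borel_measurable lebesgue"
  shows "haar_shift_star D m k g h f x \<le> pos_op f x"
  unfolding haar_shift_star_def using norm_shift_trunc_le[OF assms] by (intro SUP_least) auto

text \<open>Every finite family of cubes through x eventually fits into the window of side lengths.
  Hence unordered summability over these cubes implies convergence of the truncations as a genuine
  double limit.\<close>

lemma filterlim_scale_range:
  "filterlim (\<lambda>(e, e'). scale_range e e' x) (finite_subsets_at_top {Q\<in>D. x \<in> Q}) (at_right 0 \<times>\<^sub>F at_top)"
  unfolding filterlim_finite_subsets_at_top
proof (intro allI impI)
  fix X assume X: "finite X \<and> X \<subseteq> {Q \<in> D. x \<in> Q}"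
  have "\<forall>\<^sub>F e in at_right 0. 0 < e \<and> (\<forall>Q\<in>X. e \<le> side_length Q)"
  proof (intro eventually_conj eventually_ball_finite ballI)
    show "\<forall>\<^sub>F e::real in at_right 0. 0 < e" by (rule eventually_at_right_less)
    fix Q assume "Q \<in> X"
    then have "0 < side_length Q" using X side_length_pos by auto
    then show "\<forall>\<^sub>F e in at_right 0. e \<le> side_length Q"
      using eventually_at_right_less by (auto simp: eventually_at_right_field intro: less_imp_le)
  qed (use X in auto)
  moreover have "\<forall>\<^sub>F e' in at_top. \<forall>Q\<in>X. side_length Q \<le> e'"
    using X by (intro eventually_ball_finite) auto
  ultimately have "\<forall>\<^sub>F (e, e') in at_right 0 \<times>\<^sub>F at_top.
      (0 < e \<and> (\<forall>Q\<in>X. e \<le> side_length Q)) \<and> (\<forall>Q\<in>X. side_length Q \<le> e')"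
    unfolding eventually_prod_filter by blast
  then show "\<forall>\<^sub>F y in at_right 0 \<times>\<^sub>F at_top.
      finite (case y of (e, e') \<Rightarrow> scale_range e e' x) \<and> X \<subseteq> (case y of (e, e') \<Rightarrow> scale_range e e' x) \<and>
      (case y of (e, e') \<Rightarrow> scale_range e e' x) \<subseteq> {Q \<in> D. x \<in> Q}"
    by eventually_elim (use X finite_scale_range in \<open>auto simp: scale_range_def\<close>)
qed

text \<open>Finiteness of T f at x makes the pieces absolutely summable over the cubes through x.
  The truncations then converge, and the limit inherits their common bound.\<close>

lemma shift_limit:
  assumes "haar_families m k g h" "f \<in> borel_measurable lebesgue" "pos_op f x < \<infinity>"
  shows "shift_converges D m k g h f x" "absfun (haar_shift D m k g h f) x \<le> pos_op f x"
proof -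
  let ?s = "\<lambda>Q. shift_piece D m k g h Q f x" and ?F = "at_right (0::real) \<times>\<^sub>F (at_top :: real filter)"
  obtain B where B: "pos_op f x = ennreal B" "0 \<le> B" using assms(3) by (cases "pos_op f x") auto
  have "(\<Sum>Q\<in>S. norm (?s Q)) \<le> B" if "finite S" "S \<subseteq> {Q\<in>D. x \<in> Q}" for S
  proof -
    have "S \<subseteq> D" using that(2) by auto
    from sum_norm_shift_piece_le[OF assms(1,2) that(1) this, of x] show ?thesis
      unfolding B(1) by (simp only: ennreal_le_iff[OF B(2)])
  qed
  then have "(\<lambda>Q. norm (?s Q)) summable_on {Q\<in>D. x \<in> Q}"
    by (intro nonneg_bdd_above_summable_on bdd_aboveI2) auto
  then have "?s summable_on {Q\<in>D. x \<in> Q}" by (rule abs_summable_summable)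
  then obtain l where "(?s has_sum l) {Q\<in>D. x \<in> Q}" by (auto simp: summable_on_def)
  then have "((\<lambda>(e, e'). sum ?s (scale_range e e' x)) \<longlongrightarrow> l) ?F"
    unfolding has_sum_def using filterlim_compose[OF _ filterlim_scale_range] by (simp add: case_prod_unfold)
  moreover have pos: "\<forall>\<^sub>F (e, e'::real) in ?F. 0 < e"
    unfolding eventually_prod_filter
    by (intro exI[of _ "\<lambda>e. 0 < e"] exI[of _ "\<lambda>_. True"]) (simp add: eventually_at_right_less)
  then have "\<forall>\<^sub>F y in ?F. (case y of (e, e') \<Rightarrow> sum ?s (scale_range e e' x)) = (case y of (e, e') \<Rightarrow> shift_trunc D m k g h e e' f x)"
    by eventually_elim (auto simp: shift_trunc_eq_sum[OF assms(1,2)])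
  ultimately have lim: "((\<lambda>(e, e'). shift_trunc D m k g h e e' f x) \<longlongrightarrow> l) ?F"
    by (rule Lim_transform_eventually)
  then show "shift_converges D m k g h f x" unfolding shift_converges_def by blast
  have nt: "?F \<noteq> bot" by (simp add: prod_filter_eq_bot)
  then have eq: "haar_shift D m k g h f x = l"
    unfolding haar_shift_def using lim by (rule tendsto_Lim)
  have le: "norm (shift_trunc D m k g h e e' f x) \<le> B" if "0 < e" for e e'
    using norm_shift_trunc_le[OF assms(1,2) that, of e' x] unfolding B(1) by (simp only: ennreal_le_iff[OF B(2)])
  have "norm l \<le> B"
  proof (rule Lim_norm_ubound[OF nt lim])
    show "\<forall>\<^sub>F y in ?F. norm (case y of (e, e') \<Rightarrow> shift_trunc D m k g h e e' f x) \<le> B"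
      using pos by eventually_elim (auto intro: le)
  qed
  then show "absfun (haar_shift D m k g h f) x \<le> pos_op f x"
    by (simp add: absfun_def eq B ennreal_leI)
qed

end

text \<open>Domination is required only where the weight is positive, which is exactly where
  finiteness of T f, and with it convergence of the shift, is known a.e.\<close>

lemma Lnorm_mono:
  assumes "0 < r" "AE x in lebesgue. 0 < w x \<longrightarrow> F x \<le> G x"
  shows "Lnorm r w F \<le> Lnorm r w G"
  unfolding Lnorm_def using assms
  by (intro ennpowr_mono nn_integral_mono_AE)
    (auto elim!: eventually_mono intro: mult_right_mono ennpowr_mono simp: zero_less_iff_neq_zero)

lemma weak_Lnorm_mono:
  assumes "0 < r" "AE x in lebesgue. 0 < w x \<longrightarrow> F x \<le> G x"
  shows "weak_Lnorm r w F \<le> weak_Lnorm r w G"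
  unfolding weak_Lnorm_def
proof (intro SUP_mono' mult_left_mono ennpowr_mono nn_integral_mono_AE)
  fix t
  show "AE x in lebesgue. w x * indicator {x. ennreal t < F x} x \<le> w x * indicator {x. ennreal t < G x} x"
    using assms(2)
    by eventually_elim (auto simp: zero_less_iff_neq_zero split: split_indicator)
qed (use assms in auto)

context two_weight
begin

lemma haar_shift_bounds:
  assumes A: "dual_bound A" and f: "f \<in> Lspace p v" and S: "gen_haar_shift D m k g h"
  shows "AE x in lebesgue. 0 < u x \<longrightarrow> shift_converges D m k g h f x"
    and "AE x in lebesgue. 0 < u x \<longrightarrow> absfun (haar_shift D m k g h f) x \<le> pos_op f x"
    and "haar_shift_star D m k g h f x \<le> pos_op f x"
proof -
  have fam: "haar_families m k g h" using S by (simp add: gen_haar_shift_def haar_families_def)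
  have fm: "f \<in> borel_measurable lebesgue" using f by (simp add: Lspace_def)
  show "AE x in lebesgue. 0 < u x \<longrightarrow> shift_converges D m k g h f x"
    "AE x in lebesgue. 0 < u x \<longrightarrow> absfun (haar_shift D m k g h f) x \<le> pos_op f x"
    using pos_op_finite[OF A f] by (auto elim!: eventually_mono intro: shift_limit[OF fam fm])
  show "haar_shift_star D m k g h f x \<le> pos_op f x"
    by (rule haar_shift_star_le[OF fam fm])
qed

end

text \<open>The factor max(1, \<kappa>)^2 is at least 1, so a bound uniform in the complexity
  implies the stated form.\<close>

lemma complexity_factor_le:
  assumes "0 \<le> C"
  shows "ennreal C * t \<le> ennreal (C * (real (max 1 n))\<^sup>2) * t"
proof -
  have "1 \<le> (real (max 1 n))\<^sup>2" by (intro one_le_power) auto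
  then show ?thesis using assms by (intro mult_right_mono ennreal_leI) (auto simp: mult_le_cancel_left1)
qed

theorem theorem1p3:
  fixes D :: "(real^'n) set set" and p q :: real and u v :: "(real^'n) \<Rightarrow> ennreal"
  assumes "dyadic_grid D" and "1 < p" and "p < q" and "weight_pair u v"
  shows
    "(maximal_bounded D p v q u \<and>
      maximal_bounded D (conj_exp q) (\<lambda>x. ennpowr (u x) (1 - conj_exp q))
                        (conj_exp p) (\<lambda>x. ennpowr (v x) (1 - conj_exp p)) \<longrightarrow>
      (\<forall>B. \<exists>C::real. \<forall>m k g h. gen_haar_shift D m k g h \<and> shift_L2_bound D m k g h B \<longrightarrow>
         (\<forall>f\<in>Lspace p v.
            (AE x in lebesgue. u x > 0 \<longrightarrow> shift_converges D m k g h f x) \<and>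
            Lnorm q u (absfun (haar_shift D m k g h f))
              \<le> ennreal (C * (real (max 1 (shift_complexity m k)))\<^sup>2) * Lnorm p v (absfun f) \<and>
            Lnorm q u (haar_shift_star D m k g h f)
              \<le> ennreal (C * (real (max 1 (shift_complexity m k)))\<^sup>2) * Lnorm p v (absfun f)))) \<and>
     (maximal_bounded D (conj_exp q) (\<lambda>x. ennpowr (u x) (1 - conj_exp q))
                        (conj_exp p) (\<lambda>x. ennpowr (v x) (1 - conj_exp p)) \<longrightarrow>
      (\<forall>B. \<exists>C::real. \<forall>m k g h. gen_haar_shift D m k g h \<and> shift_L2_bound D m k g h B \<longrightarrow>
         (\<forall>f\<in>Lspace p v.
            (AE x in lebesgue. u x > 0 \<longrightarrow> shift_converges D m k g h f x) \<and>
            weak_Lnorm q u (absfun (haar_shift D m k g h f))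
              \<le> ennreal (C * (real (max 1 (shift_complexity m k)))\<^sup>2) * Lnorm p v (absfun f) \<and>
            weak_Lnorm q u (haar_shift_star D m k g h f)
              \<le> ennreal (C * (real (max 1 (shift_complexity m k)))\<^sup>2) * Lnorm p v (absfun f))))"
proof -
  interpret two_weight D p q u v
    using assms by unfold_locales
  have q0: "0 < q" using q by simp
  have dual: "\<exists>A. dual_bound A" if "maximal_bounded D q' (\<lambda>x. ennpowr (u x) (1 - q')) p' (\<lambda>x. ennpowr (v x) (1 - p'))"
    using maximal_bounded_nonneg[OF that] unfolding dual_bound_def by metis
  have primal: "\<exists>A. primal_bound A" if "maximal_bounded D p v q u"
    using maximal_bounded_nonneg[OF that] unfolding primal_bound_def by metis
  show ?thesis
  proof (intro conjI impI allI; (elim conjE)?)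
    assume "maximal_bounded D p v q u"
      "maximal_bounded D q' (\<lambda>x. ennpowr (u x) (1 - q')) p' (\<lambda>x. ennpowr (v x) (1 - p'))"
    then obtain A A' where A: "dual_bound A" and A': "primal_bound A'"
      using dual primal by blast
    \<comment> \<open>The constant of \<open>strong_bound\<close>, fixed before the shift and f are
      chosen and hence uniform over both.\<close>
    let ?C = "op_const (2 * (A + A'))"
    have C: "0 \<le> ?C" using A A' by (intro op_const_nonneg) (simp add: dual_bound_def primal_bound_def)
    show "\<exists>C::real. \<forall>m k g h. gen_haar_shift D m k g h \<and> shift_L2_bound D m k g h B \<longrightarrow>
         (\<forall>f\<in>Lspace p v.
            (AE x in lebesgue. u x > 0 \<longrightarrow> shift_converges D m k g h f x) \<and>
            Lnorm q u (absfun (haar_shift D m k g h f))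
              \<le> ennreal (C * (real (max 1 (shift_complexity m k)))\<^sup>2) * Lnorm p v (absfun f) \<and>
            Lnorm q u (haar_shift_star D m k g h f)
              \<le> ennreal (C * (real (max 1 (shift_complexity m k)))\<^sup>2) * Lnorm p v (absfun f))" for B
    proof (intro exI[of _ ?C] allI impI ballI)
      fix m k g h f
      assume "gen_haar_shift D m k g h \<and> shift_L2_bound D m k g h B" and f: "f \<in> Lspace p v"
      then have S: "gen_haar_shift D m k g h" by simp
      have "Lnorm q u F \<le> ennreal (?C * (real (max 1 (shift_complexity m k)))\<^sup>2) * Lnorm p v (absfun f)"
        if "AE x in lebesgue. 0 < u x \<longrightarrow> F x \<le> pos_op f x" for F
        using Lnorm_mono[OF q0 that] strong_bound[OF A A' f] complexity_factor_le[OF C]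
        by (meson order_trans)
      then show "(AE x in lebesgue. u x > 0 \<longrightarrow> shift_converges D m k g h f x) \<and>
            Lnorm q u (absfun (haar_shift D m k g h f))
              \<le> ennreal (?C * (real (max 1 (shift_complexity m k)))\<^sup>2) * Lnorm p v (absfun f) \<and>
            Lnorm q u (haar_shift_star D m k g h f)
              \<le> ennreal (?C * (real (max 1 (shift_complexity m k)))\<^sup>2) * Lnorm p v (absfun f)"
        using haar_shift_bounds[OF A f S] by simp
    qed
  next
    assume "maximal_bounded D q' (\<lambda>x. ennpowr (u x) (1 - q')) p' (\<lambda>x. ennpowr (v x) (1 - p'))"
    then obtain A where A: "dual_bound A"
      using dual by blast
    let ?C = "op_const (4 * A)"
    have C: "0 \<le> ?C" using A by (intro op_const_nonneg) (simp add: dual_bound_def)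
    show "\<exists>C::real. \<forall>m k g h. gen_haar_shift D m k g h \<and> shift_L2_bound D m k g h B \<longrightarrow>
         (\<forall>f\<in>Lspace p v.
            (AE x in lebesgue. u x > 0 \<longrightarrow> shift_converges D m k g h f x) \<and>
            weak_Lnorm q u (absfun (haar_shift D m k g h f))
              \<le> ennreal (C * (real (max 1 (shift_complexity m k)))\<^sup>2) * Lnorm p v (absfun f) \<and>
            weak_Lnorm q u (haar_shift_star D m k g h f)
              \<le> ennreal (C * (real (max 1 (shift_complexity m k)))\<^sup>2) * Lnorm p v (absfun f))" for B
    proof (intro exI[of _ ?C] allI impI ballI)
      fix m k g h f
      assume "gen_haar_shift D m k g h \<and> shift_L2_bound D m k g h B" and f: "f \<in> Lspace p v"
      then have S: "gen_haar_shift D m k g h" by simp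
      have "weak_Lnorm q u F \<le> ennreal (?C * (real (max 1 (shift_complexity m k)))\<^sup>2) * Lnorm p v (absfun f)"
        if "AE x in lebesgue. 0 < u x \<longrightarrow> F x \<le> pos_op f x" for F
        using weak_Lnorm_mono[OF q0 that] weak_bound[OF A f] complexity_factor_le[OF C]
        by (meson order_trans)
      then show "(AE x in lebesgue. u x > 0 \<longrightarrow> shift_converges D m k g h f x) \<and>
            weak_Lnorm q u (absfun (haar_shift D m k g h f))
              \<le> ennreal (?C * (real (max 1 (shift_complexity m k)))\<^sup>2) * Lnorm p v (absfun f) \<and>
            weak_Lnorm q u (haar_shift_star D m k g h f)
              \<le> ennreal (?C * (real (max 1 (shift_complexity m k)))\<^sup>2) * Lnorm p v (absfun f)"
        using haar_shift_bounds[OF A f S] by simp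
    qed
  qed
qed

end
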